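(* Let $f:\mathbb{C}\to\mathbb{C}$ be the holomorphic function $f(z)=\sin(e^{z^2})$ and let $\Sigma=\{(z,f(z)) : z\in\mathbb{C}\}\subset\mathbb{C}^2=\mathbb{R}^4$ be its graph. Then $\Sigma$ is a smooth stable minimal surface in $\mathbb{R}^4=\mathbb{C}^2$, and there exist constants $c>0$ and $r_0>0$ such that for all $r\ge r_0$, $$\operatorname{Area}(B_r\cap\Sigma)\ge e^{c\,r^2}.$$
   Context: $\mathbb{C}^2$ is identified with Euclidean $\mathbb{R}^4$. $B_r$ denotes the Euclidean ball of radius $r$ centered at the origin in $\mathbb{R}^4$, and $\operatorname{Area}$ is the two-dimensional area of the surface induced by the Euclidean metric. A minimal surface is stable if the second variation of area is nonnegative for all compactly supported variations. *)

theory Defs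
  imports "HOL-Analysis.Analysis"
begin

text \<open>
  \<open>C\<^sup>k\<close> and \<open>C\<^sup>\<infinity>\<close> maps; the definitions are meant for open \<open>U\<close>, where continuity of all
  iterated directional derivatives up to order \<open>k\<close> is the usual notion.
\<close>

primrec Ck_on :: "nat \<Rightarrow> 'a::euclidean_space set \<Rightarrow> ('a \<Rightarrow> 'b::euclidean_space) \<Rightarrow> bool" where
  "Ck_on 0 U f \<longleftrightarrow> continuous_on U f"
| "Ck_on (Suc k) U f \<longleftrightarrow> (\<forall>x\<in>U. f differentiable (at x)) \<and>
     (\<forall>v. Ck_on k U (\<lambda>x. frechet_derivative f (at x) v))"

definition smooth_on :: "'a::euclidean_space set \<Rightarrow> ('a \<Rightarrow> 'b::euclidean_space) \<Rightarrow> bool" where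
  "smooth_on U f \<longleftrightarrow> (\<forall>k. Ck_on k U f)"

definition local_parametrization ::
    "'a::euclidean_space set \<Rightarrow> (real^2) set \<Rightarrow> (real^2 \<Rightarrow> 'a) \<Rightarrow> bool" where
  "local_parametrization S U X \<longleftrightarrow>
     open U \<and> smooth_on U X \<and> (\<forall>u\<in>U. inj (frechet_derivative X (at u))) \<and>
     openin (top_of_set S) (X ` U) \<and> (\<exists>Y. homeomorphism U (X ` U) X Y)"

definition smooth_surface :: "'a::euclidean_space set \<Rightarrow> bool" where
  "smooth_surface S \<longleftrightarrow> (\<forall>p\<in>S. \<exists>U X. local_parametrization S U X \<and> p \<in> X ` U)"

text \<open>
  The area density \<open>sqrt (E G - F\<^sup>2)\<close> of the metric induced by a map from the plane.
\<close>

definition area_density :: "(real^2 \<Rightarrow> 'a::euclidean_space) \<Rightarrow> real^2 \<Rightarrow> real" where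
  "area_density X u =
     (let a = frechet_derivative X (at u) (axis 1 1);
          b = frechet_derivative X (at u) (axis 2 1)
      in sqrt ((a \<bullet> a) * (b \<bullet> b) - (a \<bullet> b)\<^sup>2))"

text \<open>
  The area of the map \<open>G\<close> restricted to the Borel part \<open>A\<close> of the surface \<open>S\<close>: cut \<open>A\<close> into
  countably many pieces \<open>X i ` D i\<close>, each lying in a coordinate patch, and add up the integrals
  of the area density of \<open>G\<close> over the pieces. By the change of variables formula the value
  does not depend on the way \<open>A\<close> is cut or on the parametrizations. Points of the image are
  counted with multiplicity, as usual for variations, which need not be injective.
\<close>

definition map_area :: "'a::euclidean_space set \<Rightarrow> ('a \<Rightarrow> 'a) \<Rightarrow> 'a set \<Rightarrow> ennreal" where
  "map_area S G A =
     (THE a. \<exists>(U :: nat \<Rightarrow> (real^2) set) X D.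
        (\<forall>i. local_parametrization S (U i) (X i) \<and> D i \<in> sets borel \<and> D i \<subseteq> U i) \<and>
        disjoint_family (\<lambda>i. X i ` D i) \<and> (\<Union>i. X i ` D i) = A \<and>
        a = (\<Sum>i. \<integral>\<^sup>+u\<in>D i. ennreal (area_density (G \<circ> X i) u) \<partial>lborel))"

definition area :: "'a::euclidean_space set \<Rightarrow> 'a set \<Rightarrow> ennreal" where
  "area S A = map_area S (\<lambda>p. p) A"

text \<open>
  Variations of \<open>S\<close> with support in the compact set \<open>K\<close>. Only the values of \<open>\<Phi> t\<close> on \<open>S\<close> and for
  small \<open>t\<close> matter; smoothness is joint smoothness in \<open>t\<close> and the point of \<open>S\<close>.
\<close>

definition variation :: "'a::euclidean_space set \<Rightarrow> 'a set \<Rightarrow> (real \<Rightarrow> 'a \<Rightarrow> 'a) \<Rightarrow> bool" where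
  "variation S K \<Phi> \<longleftrightarrow> compact K \<and> K \<subseteq> S \<and> (\<forall>p\<in>S. \<Phi> 0 p = p) \<and>
     (\<exists>\<epsilon>>0. (\<forall>t\<in>{-\<epsilon><..<\<epsilon>}. \<forall>p\<in>S - K. \<Phi> t p = p) \<and>
       (\<forall>U X. local_parametrization S U X \<longrightarrow>
          smooth_on ({-\<epsilon><..<\<epsilon>} \<times> U) (\<lambda>(t, u). \<Phi> t (X u))))"

definition varied_area :: "'a::euclidean_space set \<Rightarrow> 'a set \<Rightarrow> (real \<Rightarrow> 'a \<Rightarrow> 'a) \<Rightarrow> real \<Rightarrow> real" where
  "varied_area S K \<Phi> t = enn2real (map_area S (\<Phi> t) K)"

definition minimal_surface :: "'a::euclidean_space set \<Rightarrow> bool" where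
  "minimal_surface S \<longleftrightarrow> smooth_surface S \<and>
     (\<forall>K \<Phi>. variation S K \<Phi> \<longrightarrow> (varied_area S K \<Phi> has_real_derivative 0) (at 0))"

text \<open>Existence of the second derivative at \<open>0\<close> is part of the condition.\<close>

definition stable_minimal_surface :: "'a::euclidean_space set \<Rightarrow> bool" where
  "stable_minimal_surface S \<longleftrightarrow> minimal_surface S \<and>
     (\<forall>K \<Phi>. variation S K \<Phi> \<longrightarrow>
        (\<exists>A' d. (\<forall>\<^sub>F t in nhds 0. (varied_area S K \<Phi> has_real_derivative A' t) (at t)) \<and>
           (A' has_real_derivative d) (at 0) \<and> 0 \<le> d))"

end

theory Submission
  imports Defs "HOL-Complex_Analysis.Cauchy_Integral_Formula"
begin

text \<open>
  A complex curve is calibrated by the Kaehler form \<open>\<omega>(p, q) = J p \<bullet> q\<close>: by Wirtinger's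
  inequality \<open>\<omega>\<close> is at most the area density, with equality on complex curves, and by Stokes'
  theorem its integral does not change under a compactly supported variation. Hence the area of
  every such variation has a minimum at time \<open>0\<close>, so that the first derivative vanishes there and
  the second one is nonnegative; both exist by differentiation under the integral.

  For the growth of the area, let \<open>\<zeta> = exp (z\<^sup>2)\<close> run through a rectangle
  \<open>R/2 \<le> Re \<zeta> \<le> R\<close>, \<open>1/2 \<le> Im \<zeta> \<le> 1\<close> with \<open>R = exp (r\<^sup>2/2)\<close>. There \<open>sin \<zeta>\<close> is bounded and
  \<open>\<bar>z\<bar>\<^sup>2\<close> is about \<open>ln R\<close>, so that this part of the graph lies in the ball of radius \<open>r\<close>, while
  its area is at least the integral of \<open>\<bar>cos \<zeta>\<bar>\<^sup>2\<close> over the rectangle, which is at least \<open>R/64\<close>.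
\<close>

section \<open>Calculus of smooth maps\<close>

lemma frechet_derivative_cong_open:
  assumes "open U" "x \<in> U" "\<And>y. y \<in> U \<Longrightarrow> f y = g y"
  shows "frechet_derivative f (at x) = frechet_derivative g (at x)"
proof -
  have "(f has_derivative D) (at x) \<longleftrightarrow> (g has_derivative D) (at x)" for D
    using assms has_derivative_transform_within_open[of f D x UNIV U g]
      has_derivative_transform_within_open[of g D x UNIV U f] by auto
  then show ?thesis by (simp add: frechet_derivative_def)
qed

lemma frechet_derivative_eqI:
  "(f has_derivative f') (at x) \<Longrightarrow> frechet_derivative f (at x) v = f' v"
  using frechet_derivative_at by metis

lemma Ck_on_cong:
  assumes "open U" "\<And>x. x \<in> U \<Longrightarrow> f x = g x" "Ck_on k U f"
  shows "Ck_on k U g"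
  using assms(2,3)
proof (induction k arbitrary: f g)
  case 0
  then show ?case using continuous_on_cong[of U U f g] by simp
next
  case (Suc k)
  have "g differentiable (at x)" if "x \<in> U" for x
  proof -
    have "f differentiable (at x)" using Suc that by simp
    then show ?thesis
      using has_derivative_transform_within_open[of f _ x UNIV U g] assms(1) that Suc.prems(1)
      unfolding differentiable_def by blast
  qed
  moreover have "Ck_on k U (\<lambda>x. frechet_derivative g (at x) v)" for v
  proof (rule Suc.IH)
    show "frechet_derivative f (at x) v = frechet_derivative g (at x) v" if "x \<in> U" for x
      using frechet_derivative_cong_open[OF assms(1) that] Suc.prems(1) by metis
  qed (use Suc.prems in auto)
  ultimately show ?case by simp
qed

text \<open>The recursion of \<open>Ck_on\<close> is phrased with \<open>frechet_derivative\<close>;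
  here any explicit derivative will do. The closure properties below come from feeding in the sum,
  product or chain rule.\<close>

lemma Ck_on_SucI:
  assumes "open U" "\<And>x. x \<in> U \<Longrightarrow> (f has_derivative f' x) (at x)"
    "\<And>v. Ck_on k U (\<lambda>x. f' x v)"
  shows "Ck_on (Suc k) U f"
proof -
  have "Ck_on k U (\<lambda>x. frechet_derivative f (at x) v)" for v
    by (rule Ck_on_cong[OF assms(1) _ assms(3)]) (simp add: frechet_derivative_eqI[OF assms(2)])
  then show ?thesis using differentiableI[OF assms(2)] by auto
qed

lemma Ck_on_SucD:
  assumes "Ck_on (Suc k) U f"
  shows "x \<in> U \<Longrightarrow> (f has_derivative frechet_derivative f (at x)) (at x)"
    and "Ck_on k U (\<lambda>x. frechet_derivative f (at x) v)"
  using assms frechet_derivative_works by auto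

lemma Ck_on_less: "Ck_on (Suc k) U f \<Longrightarrow> Ck_on k U f"
proof (induction k arbitrary: f)
  case 0
  then show ?case
    using continuous_at_imp_continuous_on differentiable_imp_continuous_within by fastforce
next
  case (Suc k)
  then show ?case by simp
qed

lemma Ck_on_add:
  assumes "open U" "Ck_on k U f" "Ck_on k U g"
  shows "Ck_on k U (\<lambda>x. f x + g x)"
  using assms(2,3)
proof (induction k arbitrary: f g)
  case 0
  then show ?case by (auto intro: continuous_intros)
next
  case (Suc k)
  note D = Ck_on_SucD[OF Suc.prems(1)] and E = Ck_on_SucD[OF Suc.prems(2)]
  show ?case
    by (rule Ck_on_SucI[OF assms(1) has_derivative_add[OF D(1) E(1)] Suc.IH[OF D(2) E(2)]])
qed

lemma Ck_on_bounded_linear: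
  assumes "open U" "bounded_linear L" "Ck_on k U f"
  shows "Ck_on k U (\<lambda>x. L (f x))"
  using assms(3)
proof (induction k arbitrary: f)
  case 0
  then show ?case using bounded_linear.continuous_on[OF assms(2)] by auto
next
  case (Suc k)
  note D = Ck_on_SucD[OF Suc.prems]
  show ?case
    by (rule Ck_on_SucI[OF assms(1) bounded_linear.has_derivative[OF assms(2) D(1)] Suc.IH[OF D(2)]])
qed

text \<open>By the product rule. Each summand keeps one undifferentiated factor, which
  \<open>Ck_on_less\<close> brings down to order \<open>k\<close> so that the induction hypothesis
  applies.\<close>

lemma Ck_on_inner:
  assumes "open U" "Ck_on k U f" "Ck_on k U g"
  shows "Ck_on k U (\<lambda>x. f x \<bullet> g x)"
  using assms(2,3)
proof (induction k arbitrary: f g)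
  case 0
  then show ?case by (auto intro: continuous_intros)
next
  case (Suc k)
  note D = Ck_on_SucD[OF Suc.prems(1)] and E = Ck_on_SucD[OF Suc.prems(2)]
  show ?case
    by (rule Ck_on_SucI[OF assms(1) has_derivative_inner[OF D(1) E(1)] Ck_on_add[OF assms(1)
            Suc.IH[OF Ck_on_less[OF Suc.prems(1)] E(2)] Suc.IH[OF D(2) Ck_on_less[OF Suc.prems(2)]]]])
qed

text \<open>The induction runs over all exponents at once, since differentiating lowers
  \<open>s\<close> by one. The case \<open>s = 1/2\<close> serves for square roots of Gram
  determinants.\<close>

lemma Ck_on_powr:
  fixes f :: "'a::euclidean_space \<Rightarrow> real"
  assumes "open U" "Ck_on k U f" "\<And>x. x \<in> U \<Longrightarrow> f x > 0"
  shows "Ck_on k U (\<lambda>x. f x powr s)"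
  using assms(2)
proof (induction k arbitrary: s)
  case 0
  then show ?case using assms(3) by (force intro!: continuous_intros)
next
  case (Suc k)
  show ?case
  proof (rule Ck_on_SucI[OF assms(1)])
    show "((\<lambda>x. f x powr s) has_derivative
        (\<lambda>v. (s *\<^sub>R (f x powr (s - 1))) \<bullet> frechet_derivative f (at x) v)) (at x)" if "x \<in> U" for x
    proof -
      have "((\<lambda>y. y powr s) has_real_derivative s * f x powr (s - 1)) (at (f x))"
        using assms(3)[OF that] by (auto intro!: derivative_eq_intros)
      from DERIV_compose_FDERIV[OF this Ck_on_SucD(1)[OF Suc.prems that]]
      show ?thesis by (simp add: mult.commute)
    qed
    show "Ck_on k U (\<lambda>x. (s *\<^sub>R (f x powr (s - 1))) \<bullet> frechet_derivative f (at x) v)" for v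
      by (intro Ck_on_inner assms(1) Ck_on_bounded_linear[OF assms(1) bounded_linear_scaleR_right]
          Suc.IH Ck_on_less[OF Suc.prems] Ck_on_SucD(2)[OF Suc.prems])
  qed
qed

lemma Ck_on_subset: "Ck_on k U f \<Longrightarrow> V \<subseteq> U \<Longrightarrow> Ck_on k V f"
  by (induction k arbitrary: f) (auto intro: continuous_on_subset)

lemma smooth_on_has_derivative:
  "smooth_on U f \<Longrightarrow> x \<in> U \<Longrightarrow> (f has_derivative frechet_derivative f (at x)) (at x)"
  unfolding smooth_on_def using Ck_on_SucD(1) by blast

lemma smooth_on_frechet_derivative:
  "smooth_on U f \<Longrightarrow> smooth_on U (\<lambda>x. frechet_derivative f (at x) v)"
  unfolding smooth_on_def using Ck_on_SucD(2) by blast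

lemma smooth_on_imp_continuous_on: "smooth_on U f \<Longrightarrow> continuous_on U f"
  unfolding smooth_on_def using Ck_on.simps(1) by blast

lemma smooth_on_subset: "smooth_on U f \<Longrightarrow> V \<subseteq> U \<Longrightarrow> smooth_on V f"
  unfolding smooth_on_def using Ck_on_subset by blast

lemma smooth_on_bounded_linear:
  "open U \<Longrightarrow> bounded_linear L \<Longrightarrow> smooth_on U f \<Longrightarrow> smooth_on U (\<lambda>x. L (f x))"
  unfolding smooth_on_def using Ck_on_bounded_linear by blast

lemma smooth_on_add:
  "open U \<Longrightarrow> smooth_on U f \<Longrightarrow> smooth_on U g \<Longrightarrow> smooth_on U (\<lambda>x. f x + g x)"
  unfolding smooth_on_def using Ck_on_add by blast

lemma smooth_on_diff:
  assumes "open U" "smooth_on U f" "smooth_on U g"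
  shows "smooth_on U (\<lambda>x. f x - g x)"
  using smooth_on_add[OF assms(1,2) smooth_on_bounded_linear[OF assms(1)
        bounded_linear_minus[OF bounded_linear_ident] assms(3)]] by simp

lemma smooth_on_inner:
  "open U \<Longrightarrow> smooth_on U f \<Longrightarrow> smooth_on U g \<Longrightarrow> smooth_on U (\<lambda>x. f x \<bullet> g x)"
  unfolding smooth_on_def using Ck_on_inner by blast

lemma smooth_on_mult:
  fixes f g :: "'a::euclidean_space \<Rightarrow> real"
  shows "open U \<Longrightarrow> smooth_on U f \<Longrightarrow> smooth_on U g \<Longrightarrow> smooth_on U (\<lambda>x. f x * g x)"
  using smooth_on_inner[of U f g] by simp

lemma smooth_on_powr:
  fixes f :: "'a::euclidean_space \<Rightarrow> real"
  shows "open U \<Longrightarrow> smooth_on U f \<Longrightarrow> (\<And>x. x \<in> U \<Longrightarrow> f x > 0) \<Longrightarrow> smooth_on U (\<lambda>x. f x powr s)"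
  unfolding smooth_on_def using Ck_on_powr by blast

text \<open>Induction on the order, since derivatives of members of \<open>P\<close> are members
  again. This gives smoothness of maps with holomorphic components without writing out iterated
  derivatives.\<close>

lemma smooth_on_coinduct:
  assumes "P f" and U: "open U"
    and P: "\<And>f. P f \<Longrightarrow> \<exists>f'. (\<forall>x\<in>U. (f has_derivative f' x) (at x)) \<and> (\<forall>v. P (\<lambda>x. f' x v))"
  shows "smooth_on U f"
proof -
  have "Ck_on k U f" if "P f" for k f
    using that
  proof (induction k arbitrary: f)
    case 0
    obtain f' where "\<And>x. x \<in> U \<Longrightarrow> (f has_derivative f' x) (at x)"
      using P[OF 0] by auto
    then have "continuous (at x) f" if "x \<in> U" for x
      using has_derivative_continuous that by blast
    then show ?case using continuous_at_imp_continuous_on by auto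
  next
    case (Suc k)
    obtain f' where "\<And>x. x \<in> U \<Longrightarrow> (f has_derivative f' x) (at x)" "\<And>v. P (\<lambda>x. f' x v)"
      using P[OF Suc.prems] by auto
    then show ?case using Suc.IH by (intro Ck_on_SucI[OF U]) auto
  qed
  then show ?thesis using assms(1) by (simp add: smooth_on_def)
qed

section \<open>Symmetry of second derivatives\<close>

lemma has_real_derivative_along_line:
  fixes f :: "'a::real_normed_vector \<Rightarrow> real"
  assumes "(f has_derivative f') (at (p + s *\<^sub>R v))"
  shows "((\<lambda>s. f (p + s *\<^sub>R v)) has_real_derivative f' v) (at s within T)"
proof -
  have "((\<lambda>s. p + s *\<^sub>R v) has_derivative (\<lambda>h. h *\<^sub>R v)) (at s within T)"
    by (auto intro!: derivative_eq_intros)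
  from has_derivative_compose[where g=f and f="\<lambda>s. p + s *\<^sub>R v", OF this assms]
  moreover have "(*) (f' v) = (\<lambda>h. h * f' v)" by (simp add: fun_eq_iff)
  ultimately show ?thesis
    using linear_scale[OF has_derivative_linear[OF assms], of _ v]
    by (simp add: has_field_derivative_def)
qed

text \<open>The mean value theorem is used twice: in \<open>s\<close> for the increment of
  \<open>f\<close> along \<open>h *\<^sub>R w\<close>, then in \<open>r\<close> for the derivative
  of that increment.\<close>

lemma second_difference_eq:
  fixes f :: "'a::euclidean_space \<Rightarrow> real"
  assumes f: "Ck_on 2 U f" and h: "h > 0"
    and sub: "\<And>s r. 0 \<le> s \<Longrightarrow> s \<le> h \<Longrightarrow> 0 \<le> r \<Longrightarrow> r \<le> h \<Longrightarrow> x + s *\<^sub>R v + r *\<^sub>R w \<in> U"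
  shows "\<exists>s r. 0 < s \<and> s < h \<and> 0 < r \<and> r < h \<and>
    f (x + h *\<^sub>R v + h *\<^sub>R w) - f (x + h *\<^sub>R v) - f (x + h *\<^sub>R w) + f x =
    h\<^sup>2 * frechet_derivative (\<lambda>x. frechet_derivative f (at x) v) (at (x + s *\<^sub>R v + r *\<^sub>R w)) w"
proof -
  let ?D = "\<lambda>v x. frechet_derivative f (at x) v"
  have f2: "Ck_on (Suc (Suc 0)) U f" using f by (simp only: numeral_2_eq_2)
  have 1: "((\<lambda>s. f (x + s *\<^sub>R v + r *\<^sub>R w)) has_real_derivative ?D v (x + s *\<^sub>R v + r *\<^sub>R w)) (at s)"
    if "0 \<le> s" "s \<le> h" "0 \<le> r" "r \<le> h" for s r
    using has_real_derivative_along_line[of f _ "x + r *\<^sub>R w" s v]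
      Ck_on_SucD(1)[OF f2 sub[OF that]] by (simp add: add_ac)
  have 2: "((\<lambda>r. ?D v (x + s *\<^sub>R v + r *\<^sub>R w)) has_real_derivative
      frechet_derivative (?D v) (at (x + s *\<^sub>R v + r *\<^sub>R w)) w) (at r)"
    if "0 \<le> s" "s \<le> h" "0 \<le> r" "r \<le> h" for s r
    using has_real_derivative_along_line[of "?D v" _ "x + s *\<^sub>R v" r w]
      Ck_on_SucD(1)[OF Ck_on_SucD(2)[OF f2] sub[OF that]] by blast
  define \<phi> where "\<phi> = (\<lambda>s. f (x + s *\<^sub>R v + h *\<^sub>R w) - f (x + s *\<^sub>R v))"
  have "(\<phi> has_real_derivative ?D v (x + s *\<^sub>R v + h *\<^sub>R w) - ?D v (x + s *\<^sub>R v)) (at s)"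
    if "0 \<le> s" "s \<le> h" for s
    unfolding \<phi>_def using that h 1[of s h] 1[of s 0] by (auto intro!: derivative_intros)
  from MVT2[OF h this] obtain s where s: "0 < s" "s < h"
    "\<phi> h - \<phi> 0 = h * (?D v (x + s *\<^sub>R v + h *\<^sub>R w) - ?D v (x + s *\<^sub>R v))" by auto
  from MVT2[OF h 2[of s]] s obtain r where r: "0 < r" "r < h"
    "?D v (x + s *\<^sub>R v + h *\<^sub>R w) - ?D v (x + s *\<^sub>R v)
      = h * frechet_derivative (?D v) (at (x + s *\<^sub>R v + r *\<^sub>R w)) w" by auto
  have "\<phi> h - \<phi> 0 = h\<^sup>2 * frechet_derivative (?D v) (at (x + s *\<^sub>R v + r *\<^sub>R w)) w"
    unfolding s(3) r(3) by (simp add: power2_eq_square)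
  moreover have "\<phi> h - \<phi> 0 = f (x + h *\<^sub>R v + h *\<^sub>R w) - f (x + h *\<^sub>R v) - f (x + h *\<^sub>R w) + f x"
    by (simp add: \<phi>_def)
  ultimately show ?thesis using s(1,2) r(1,2) by metis
qed

text \<open>Schwarz's theorem. The second difference over a small parallelogram is symmetric in
  \<open>v\<close> and \<open>w\<close>, and by \<open>second_difference_eq\<close> it is
  \<open>h\<^sup>2\<close> times either mixed derivative at a nearby point; continuity of both at
  \<open>x\<close> finishes the proof.\<close>

lemma second_derivative_symmetric_real:
  fixes f :: "'a::euclidean_space \<Rightarrow> real"
  assumes f: "Ck_on 2 U f" and "open U" and x: "x \<in> U"
  shows "frechet_derivative (\<lambda>x. frechet_derivative f (at x) v) (at x) w =
    frechet_derivative (\<lambda>x. frechet_derivative f (at x) w) (at x) v"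
proof -
  let ?A = "\<lambda>v w x. frechet_derivative (\<lambda>x. frechet_derivative f (at x) v) (at x) w"
  have f2: "Ck_on (Suc (Suc 0)) U f" using f by (simp only: numeral_2_eq_2)
  have cont: "continuous (at x) (?A v w)" for v w
    using Ck_on_SucD(2)[OF Ck_on_SucD(2)[OF f2], of v w] continuous_on_eq_continuous_at[OF \<open>open U\<close>] x
    unfolding Ck_on.simps(1) by blast
  have "\<bar>?A v w x - ?A w v x\<bar> \<le> \<eta>" if \<eta>: "\<eta> > 0" for \<eta>
  proof -
    obtain d1 where d1: "d1 > 0" "\<And>y. dist y x < d1 \<Longrightarrow> dist (?A v w y) (?A v w x) < \<eta>/2"
      using cont[of v w] \<eta> unfolding continuous_at_eps_delta by (meson half_gt_zero)
    obtain d2 where d2: "d2 > 0" "\<And>y. dist y x < d2 \<Longrightarrow> dist (?A w v y) (?A w v x) < \<eta>/2"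
      using cont[of w v] \<eta> unfolding continuous_at_eps_delta by (meson half_gt_zero)
    obtain d3 where d3: "d3 > 0" "ball x d3 \<subseteq> U" using x \<open>open U\<close> open_contains_ball by blast
    define d where "d = min d1 (min d2 d3)"
    \<comment> \<open>With this step the whole parallelogram stays within distance \<open>d\<close>
      of \<open>x\<close>; the summand 1 keeps the denominator positive when \<open>v\<close> and
      \<open>w\<close> vanish.\<close>
    define h where "h = d / (norm v + norm w + 1)"
    have d: "d > 0" using d1 d2 d3 by (simp add: d_def)
    have nn: "norm v + norm w + 1 > 0" by (simp add: add_nonneg_pos)
    have h: "h > 0" using d nn by (simp add: h_def)
    have hd: "h * (norm v + norm w) < d"
    proof -
      have "h * (norm v + norm w + 1) = d" using nn by (simp add: h_def)
      then show ?thesis using h by (simp add: algebra_simps)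
    qed
    have near: "dist (x + s *\<^sub>R v' + r *\<^sub>R w') x < d"
      if "0 \<le> s" "s \<le> h" "0 \<le> r" "r \<le> h" "norm v' + norm w' = norm v + norm w" for s r v' w'
    proof -
      have "dist (x + s *\<^sub>R v' + r *\<^sub>R w') x \<le> s * norm v' + r * norm w'"
        using that norm_triangle_ineq[of "s *\<^sub>R v'" "r *\<^sub>R w'"] by (simp add: dist_norm add.assoc)
      also have "\<dots> \<le> h * norm v' + h * norm w'"
        using that by (intro add_mono mult_right_mono) auto
      finally show ?thesis using hd that(5) by (metis distrib_left le_less_trans)
    qed
    have inU: "y \<in> U" if "dist y x < d" for y
      using d3 that by (auto simp: d_def dist_commute subset_iff)
    obtain s r where sr: "0 < s" "s < h" "0 < r" "r < h"
      "f (x + h *\<^sub>R v + h *\<^sub>R w) - f (x + h *\<^sub>R v) - f (x + h *\<^sub>R w) + f x = h\<^sup>2 * ?A v w (x + s *\<^sub>R v + r *\<^sub>R w)"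
      using second_difference_eq[OF f h, of x v w] near inU by auto
    obtain s' r' where sr': "0 < s'" "s' < h" "0 < r'" "r' < h"
      "f (x + h *\<^sub>R w + h *\<^sub>R v) - f (x + h *\<^sub>R w) - f (x + h *\<^sub>R v) + f x = h\<^sup>2 * ?A w v (x + s' *\<^sub>R w + r' *\<^sub>R v)"
      using second_difference_eq[OF f h, of x w v] near[where v'=w and w'=v] inU by (auto simp: add.commute)
    have "h\<^sup>2 * ?A v w (x + s *\<^sub>R v + r *\<^sub>R w) = h\<^sup>2 * ?A w v (x + s' *\<^sub>R w + r' *\<^sub>R v)"
    proof -
      have "x + h *\<^sub>R w + h *\<^sub>R v = x + h *\<^sub>R v + h *\<^sub>R w" by (simp add: add_ac)
      from sr'(5)[unfolded this] sr(5) show ?thesis by linarith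
    qed
    then have eq: "?A v w (x + s *\<^sub>R v + r *\<^sub>R w) = ?A w v (x + s' *\<^sub>R w + r' *\<^sub>R v)" using h by simp
    have "dist (?A v w (x + s *\<^sub>R v + r *\<^sub>R w)) (?A v w x) < \<eta>/2"
      using near[of s r v w] sr by (intro d1) (auto simp: d_def)
    moreover have "dist (?A w v (x + s' *\<^sub>R w + r' *\<^sub>R v)) (?A w v x) < \<eta>/2"
      using near[of s' r' w v] sr' by (intro d2) (auto simp: d_def)
    ultimately show ?thesis unfolding eq dist_real_def by linarith
  qed
  then show ?thesis by (metis abs_le_zero_iff eq_iff_diff_eq_0 field_le_epsilon add.left_neutral)
qed

text \<open>The real case is applied to each coordinate \<open>f x \<bullet> b\<close>, whose
  derivatives are those of \<open>f\<close> paired with \<open>b\<close>.\<close>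

lemma second_derivative_symmetric:
  fixes f :: "'a::euclidean_space \<Rightarrow> 'b::euclidean_space"
  assumes f: "Ck_on 2 U f" and U: "open U" and x: "x \<in> U"
  shows "frechet_derivative (\<lambda>x. frechet_derivative f (at x) v) (at x) w =
    frechet_derivative (\<lambda>x. frechet_derivative f (at x) w) (at x) v"
proof (rule euclidean_eqI)
  fix b :: 'b
  have f2: "Ck_on (Suc (Suc 0)) U f" using f by (simp only: numeral_2_eq_2)
  have 1: "frechet_derivative (\<lambda>x. f x \<bullet> b) (at y) v = frechet_derivative f (at y) v \<bullet> b"
    if "y \<in> U" for y v
    by (rule frechet_derivative_eqI) (intro has_derivative_inner_left Ck_on_SucD(1)[OF f2 that])
  have 2: "frechet_derivative (\<lambda>x. frechet_derivative (\<lambda>x. f x \<bullet> b) (at x) v) (at x) w =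
      frechet_derivative (\<lambda>x. frechet_derivative f (at x) v) (at x) w \<bullet> b" for v w
  proof -
    have "frechet_derivative (\<lambda>x. frechet_derivative (\<lambda>x. f x \<bullet> b) (at x) v) (at x) =
      frechet_derivative (\<lambda>x. frechet_derivative f (at x) v \<bullet> b) (at x)"
      by (rule frechet_derivative_cong_open[OF U x]) (rule 1)
    then have "frechet_derivative (\<lambda>x. frechet_derivative (\<lambda>x. f x \<bullet> b) (at x) v) (at x) w =
      frechet_derivative (\<lambda>x. frechet_derivative f (at x) v \<bullet> b) (at x) w" by simp
    also have "\<dots> = frechet_derivative (\<lambda>x. frechet_derivative f (at x) v) (at x) w \<bullet> b"
      by (rule frechet_derivative_eqI)
        (intro has_derivative_inner_left Ck_on_SucD(1)[OF Ck_on_SucD(2)[OF f2] x])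
    finally show ?thesis .
  qed
  have "Ck_on 2 U (\<lambda>x. f x \<bullet> b)"
    by (rule Ck_on_bounded_linear[OF U bounded_linear_inner_left f])
  from second_derivative_symmetric_real[OF this U x, of v w]
  show "frechet_derivative (\<lambda>x. frechet_derivative f (at x) v) (at x) w \<bullet> b =
    frechet_derivative (\<lambda>x. frechet_derivative f (at x) w) (at x) v \<bullet> b" by (simp add: 2)
qed

section \<open>Integrals of derivatives, differentiation under the integral sign, and minima\<close>

text \<open>The integrals of the translates of \<open>N\<close> do not depend on the translation.\<close>

lemma integral_directional_derivative_eq_0:
  fixes N :: "'a::euclidean_space \<Rightarrow> real"
  assumes K: "closed K" "K \<subseteq> cbox a b"
    and der: "\<And>x. (N has_derivative N' x) (at x)"
    and cont: "continuous_on UNIV (\<lambda>x. N' x v)"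
    and zero: "\<And>x. x \<notin> K \<Longrightarrow> N x = 0"
  shows "integral (cbox a b) (\<lambda>x. N' x v) = 0"
proof -
  have contN: "continuous_on S N" for S
    using der has_derivative_continuous continuous_at_imp_continuous_on by blast
  \<comment> \<open>\<open>N\<close> is constant on the open complement of \<open>K\<close>, so its
    derivative vanishes there; this allows passing between the two boxes at the end.\<close>
  have zero': "N' x v = 0" if "x \<notin> K" for x
  proof -
    have "((\<lambda>_. 0) has_derivative N' x) (at x)"
      by (rule has_derivative_transform_within_open[OF der, of "- K"]) (use K that zero in auto)
    then show ?thesis
      using has_derivative_unique[of "\<lambda>_. 0" "N' x" x "\<lambda>_. 0"] by auto
  qed
  obtain M where M: "\<And>x. x \<in> cbox a b \<Longrightarrow> norm x \<le> M"
    using bounded_cbox[of a b] unfolding bounded_iff by blast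
  \<comment> \<open>This larger box contains every translate of \<open>cbox a b\<close> by
    \<open>s *\<^sub>R v\<close> with |s| \<le> 1.\<close>
  obtain c where c: "cball 0 (M + norm v) \<subseteq> cbox (-c) (c::'a)"
    using bounded_subset_cbox_symmetric[OF bounded_cball] by metis
  let ?B = "cbox (-c) c"
  have sub: "x - s *\<^sub>R v \<in> ?B" if "x \<in> cbox a b" "\<bar>s\<bar> \<le> 1" for x s
  proof -
    have "norm (x - s *\<^sub>R v) \<le> norm x + \<bar>s\<bar> * norm v"
      using norm_triangle_ineq4[of x "s *\<^sub>R v"] by simp
    also have "\<dots> \<le> M + norm v"
      using M[OF that(1)] that(2) by (intro add_mono) (auto simp: mult_left_le_one_le)
    finally show ?thesis using c by (auto simp: subset_iff)
  qed
  have const: "integral ?B (\<lambda>x. N (x + s *\<^sub>R v)) = integral (cbox a b) N" if "\<bar>s\<bar> \<le> 1" for s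
  proof -
    have "(N has_integral integral (cbox a b) N) (cbox a b)"
      by (intro integrable_integral integrable_continuous contN)
    from has_integral_affinity[OF this, of 1 "s *\<^sub>R v"]
    have *: "((\<lambda>x. N (x + s *\<^sub>R v)) has_integral integral (cbox a b) N)
        ((\<lambda>x. x + - (s *\<^sub>R v)) ` cbox a b)" by simp
    have "((\<lambda>x. N (x + s *\<^sub>R v)) has_integral integral (cbox a b) N) ?B"
    proof (rule has_integral_on_superset[OF *])
      show "N (x + s *\<^sub>R v) = 0" if "x \<notin> (\<lambda>x. x + - (s *\<^sub>R v)) ` cbox a b" for x
      proof (rule zero)
        show "x + s *\<^sub>R v \<notin> K"
        proof
          assume "x + s *\<^sub>R v \<in> K"
          then have "(x + s *\<^sub>R v) + - (s *\<^sub>R v) \<in> (\<lambda>x. x + - (s *\<^sub>R v)) ` cbox a b"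
            using K by blast
          then show False using that by simp
        qed
      qed
      show "(\<lambda>x. x + - (s *\<^sub>R v)) ` cbox a b \<subseteq> ?B" using sub[OF _ that] by auto
    qed
    then show ?thesis by (rule integral_unique)
  qed
  \<comment> \<open>Differentiation under the integral sign at \<open>s = 0\<close>; the
    differentiated function is constant by \<open>const\<close>, so the result is 0.\<close>
  have "((\<lambda>s. integral ?B (\<lambda>x. N (x + s *\<^sub>R v))) has_real_derivative
      integral ?B (\<lambda>x. N' (x + 0 *\<^sub>R v) v)) (at 0 within {-1..1})"
  proof (rule leibniz_rule_field_derivative)
    show "((\<lambda>s. N (x + s *\<^sub>R v)) has_real_derivative N' (x + s *\<^sub>R v) v) (at s within {-1..1})"
      for s x
      by (rule has_real_derivative_along_line[OF der])
    show "(\<lambda>x. N (x + s *\<^sub>R v)) integrable_on ?B" for s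
      by (intro integrable_continuous continuous_on_compose2[OF contN[of UNIV]] continuous_intros) auto
    show "continuous_on ({-1..1} \<times> ?B) (\<lambda>(s, x). N' (x + s *\<^sub>R v) v)"
      unfolding split_beta
      by (rule continuous_on_compose2[OF cont]) (auto intro!: continuous_intros)
  qed auto
  moreover have "((\<lambda>s. integral ?B (\<lambda>x. N (x + s *\<^sub>R v))) has_real_derivative 0) (at 0 within {-1..1})"
    by (rule has_field_derivative_transform_within[where d=1 and f="\<lambda>_. integral (cbox a b) N"])
      (use const in \<open>auto simp: dist_real_def\<close>)
  ultimately have "integral ?B (\<lambda>x. N' x v) = 0"
    using DERIV_unique[of _ _ 0 0] at_within_interior[of 0 "{-1..1::real}"] by simp
  moreover have "integral ?B (\<lambda>x. N' x v) = integral (cbox a b) (\<lambda>x. N' x v)"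
  proof (rule integral_unique)
    have "((\<lambda>x. N' x v) has_integral integral (cbox a b) (\<lambda>x. N' x v)) (cbox a b)"
      by (intro integrable_integral integrable_continuous continuous_on_subset[OF cont]) auto
    then show "((\<lambda>x. N' x v) has_integral integral (cbox a b) (\<lambda>x. N' x v)) ?B"
      by (rule has_integral_on_superset) (use zero' K sub[where s=0] in auto)
  qed
  ultimately show ?thesis by simp
qed

text \<open>Leibniz's rule on a compact box. The new integrand is again smooth on \<open>W\<close>,
  so the lemma can be applied once more for second derivatives.\<close>

lemma has_real_derivative_integral_smooth:
  fixes \<sigma> :: "real \<times> 'a::euclidean_space \<Rightarrow> real"
  assumes \<sigma>: "smooth_on W \<sigma>" and sub: "{-\<delta><..<\<delta>} \<times> cbox a b \<subseteq> W" and t: "\<bar>t\<bar> < \<delta>"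
  shows "((\<lambda>t. integral (cbox a b) (\<lambda>u. \<sigma> (t, u))) has_real_derivative
    integral (cbox a b) (\<lambda>u. frechet_derivative \<sigma> (at (t, u)) (1, 0))) (at t)"
proof -
  have "((\<lambda>t. integral (cbox a b) (\<lambda>u. \<sigma> (t, u))) has_real_derivative
    integral (cbox a b) (\<lambda>u. frechet_derivative \<sigma> (at (t, u)) (1, 0))) (at t within {-\<delta><..<\<delta>})"
  proof (rule leibniz_rule_field_derivative[where f="\<lambda>t u. \<sigma> (t, u)"
        and fx="\<lambda>t u. frechet_derivative \<sigma> (at (t, u)) (1, 0)"])
    show "((\<lambda>t. \<sigma> (t, u)) has_real_derivative frechet_derivative \<sigma> (at (t, u)) (1, 0))
        (at t within {-\<delta><..<\<delta>})" if "t \<in> {-\<delta><..<\<delta>}" "u \<in> cbox a b" for t u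
    proof -
      have "(t, u) \<in> W" using sub that by auto
      from smooth_on_has_derivative[OF \<sigma> this] show ?thesis
        using has_real_derivative_along_line[of \<sigma> _ "(0, u)" t "(1, 0)"] by simp
    qed
    show "(\<lambda>u. \<sigma> (t, u)) integrable_on cbox a b" if "t \<in> {-\<delta><..<\<delta>}" for t
      by (intro integrable_continuous continuous_on_compose2[OF smooth_on_imp_continuous_on[OF \<sigma>]]
          continuous_intros) (use that sub in auto)
    show "continuous_on ({-\<delta><..<\<delta>} \<times> cbox a b) (\<lambda>(t, u). frechet_derivative \<sigma> (at (t, u)) (1, 0))"
      unfolding split_beta prod.collapse
      by (rule continuous_on_subset[OF smooth_on_imp_continuous_on[OF smooth_on_frechet_derivative[OF \<sigma>]] sub])
  qed (use t in auto)
  moreover have "at t within {-\<delta><..<\<delta>} = at t"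
    using t by (intro at_within_open) auto
  ultimately show ?thesis by metis
qed

text \<open>Fermat's criterion gives the first part. If \<open>d\<close> were negative,
  \<open>A'\<close> would be negative just to the right of 0, and the mean value theorem would put
  \<open>A h\<close> below \<open>A 0\<close>.\<close>

lemma local_min_second_derivative_nonneg:
  fixes A :: "real \<Rightarrow> real"
  assumes "\<delta> > 0" and A: "\<And>t. \<bar>t\<bar> < \<delta> \<Longrightarrow> (A has_real_derivative A' t) (at t)"
    and A': "(A' has_real_derivative d) (at 0)" and min: "\<And>t. \<bar>t\<bar> < \<delta> \<Longrightarrow> A 0 \<le> A t"
  shows "A' 0 = 0" "0 \<le> d"
proof -
  show 0: "A' 0 = 0"
    by (rule DERIV_local_min[OF A \<open>\<delta> > 0\<close>]) (use assms in auto)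
  show "0 \<le> d"
  proof (rule ccontr)
    assume "\<not> 0 \<le> d"
    then obtain e where e: "e > 0" "\<And>h. h > 0 \<Longrightarrow> h < e \<Longrightarrow> A' (0 + h) < A' 0"
      using DERIV_neg_dec_right[OF A'] by auto
    define h where "h = min e \<delta> / 2"
    have h: "0 < h" "h < e" "h < \<delta>" using e \<open>\<delta> > 0\<close> by (auto simp: h_def)
    obtain z where z: "0 < z" "z < h" "A h - A 0 = (h - 0) * A' z"
      using MVT2[OF h(1), of A A'] A h by auto
    have "h * A' z < 0" using e(2)[of z] z h 0 by (simp add: mult_pos_neg)
    then show False using min[of h] z h by simp
  qed
qed

section \<open>Area in a global parametrization\<close>

text \<open>Nonnegativity turns absolute integrability into integrability, so the change of
  variables theorem says that one side has the finite value \<open>r\<close> exactly if the other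
  has. Hence if one side is infinite, so is the other.\<close>

lemma nn_integral_change_of_variables:
  fixes f :: "real^'m::{finite,wellorder} \<Rightarrow> real" and g :: "real^'m::_ \<Rightarrow> real^'m::_"
  assumes S: "S \<in> sets lebesgue"
    and der: "\<And>x. x \<in> S \<Longrightarrow> (g has_derivative g' x) (at x within S)"
    and inj: "inj_on g S" and nonneg: "\<And>x. f x \<ge> 0"
    and meas1: "(\<lambda>x. indicator S x * (\<bar>det (matrix (g' x))\<bar> * f (g x))) \<in> borel_measurable lebesgue"
    and meas2: "(\<lambda>x. indicator (g ` S) x * f x) \<in> borel_measurable lebesgue"
  shows "(\<integral>\<^sup>+x\<in>S. ennreal (\<bar>det (matrix (g' x))\<bar> * f (g x)) \<partial>lborel) = (\<integral>\<^sup>+x\<in>g ` S. ennreal (f x) \<partial>lborel)"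
proof -
  let ?F = "\<lambda>x. indicator S x * (\<bar>det (matrix (g' x))\<bar> * f (g x))"
  let ?G = "\<lambda>x. indicator (g ` S) x * f x"
  have "(?F has_integral r) UNIV \<longleftrightarrow> (?G has_integral r) UNIV" for r
  proof -
    have "(\<lambda>x. \<bar>det (matrix (g' x))\<bar> * f (g x)) absolutely_integrable_on S \<and>
        integral S (\<lambda>x. \<bar>det (matrix (g' x))\<bar> * f (g x)) = r
      \<longleftrightarrow> f absolutely_integrable_on (g ` S) \<and> integral (g ` S) f = r"
      \<comment> \<open>This theorem concerns vector-valued functions, so the scalar integrand is
        viewed in \<open>real^1\<close>.\<close>
      using has_absolute_integral_change_of_variables[OF S der inj, where f="\<lambda>x. vec (f x) :: real^1" and b="vec r"]
      by (simp add: absolutely_integrable_on_1_iff integral_on_1_eq)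
    then have "((\<lambda>x. \<bar>det (matrix (g' x))\<bar> * f (g x)) has_integral r) S \<longleftrightarrow> (f has_integral r) (g ` S)"
      using nonneg by (simp add: absolutely_integrable_on_iff_nonneg has_integral_iff)
    moreover have "?F = (\<lambda>x. if x \<in> S then \<bar>det (matrix (g' x))\<bar> * f (g x) else 0)"
      "?G = (\<lambda>x. if x \<in> g ` S then f x else 0)"
      by (auto simp: fun_eq_iff)
    ultimately show ?thesis by (simp only: has_integral_restrict_UNIV)
  qed
  then have *: "(integral\<^sup>N lebesgue ?F = ennreal r \<and> 0 \<le> r) \<longleftrightarrow> (integral\<^sup>N lebesgue ?G = ennreal r \<and> 0 \<le> r)" for r
    using has_integral_iff_nn_integral_lebesgue[of ?F r] has_integral_iff_nn_integral_lebesgue[of ?G r]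
      meas1 meas2 nonneg by simp
  have "integral\<^sup>N lebesgue ?F = integral\<^sup>N lebesgue ?G"
  proof (cases "integral\<^sup>N lebesgue ?F")
    case (real r)
    then show ?thesis using * by metis
  next
    case top
    then show ?thesis using * by (cases "integral\<^sup>N lebesgue ?G") auto
  qed
  moreover have "(\<integral>\<^sup>+x\<in>S. ennreal (\<bar>det (matrix (g' x))\<bar> * f (g x)) \<partial>lborel) = integral\<^sup>N lborel ?F"
    "(\<integral>\<^sup>+x\<in>g ` S. ennreal (f x) \<partial>lborel) = integral\<^sup>N lborel ?G"
    by (auto intro!: nn_integral_cong split: split_indicator)
  ultimately show ?thesis by (simp add: nn_integral_completion)
qed

lemma area_density_nonneg: "area_density X u \<ge> 0"
  unfolding area_density_def Let_def
  by (simp add: Cauchy_Schwarz_ineq)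

text \<open>A linear change of a pair of vectors multiplies their Gram determinant by the square of
  its own determinant; taking roots leaves the absolute Jacobian.\<close>

lemma area_density_compose:
  assumes Z: "(Z has_derivative Z') (at (h u))" and h: "(h has_derivative h') (at u)"
  shows "area_density (Z \<circ> h) u = \<bar>det (matrix h')\<bar> * area_density Z (h u)"
proof -
  have D: "frechet_derivative (Z \<circ> h) (at u) = Z' \<circ> h'"
    using diff_chain_at[OF h Z] frechet_derivative_at by metis
  have DZ: "frechet_derivative Z (at (h u)) = Z'"
    using Z frechet_derivative_at by metis
  interpret Z: linear Z' using Z has_derivative_linear by blast
  let ?m = "\<lambda>i j. matrix h' $ i $ j"
  let ?p = "Z' (axis 1 1)" and ?q = "Z' (axis 2 1)"
  have ax: "h' (axis j 1) = ?m 1 j *\<^sub>R axis 1 1 + ?m 2 j *\<^sub>R axis 2 1" for j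
    by (simp add: matrix_def vec_eq_iff forall_2 axis_def)
  have Zax: "Z' (h' (axis j 1)) = ?m 1 j *\<^sub>R ?p + ?m 2 j *\<^sub>R ?q" for j
    unfolding ax by (simp add: Z.add Z.scale)
  have "(Z' (h' (axis 1 1)) \<bullet> Z' (h' (axis 1 1))) * (Z' (h' (axis 2 1)) \<bullet> Z' (h' (axis 2 1)))
      - (Z' (h' (axis 1 1)) \<bullet> Z' (h' (axis 2 1)))\<^sup>2
    = (det (matrix h'))\<^sup>2 * ((?p \<bullet> ?p) * (?q \<bullet> ?q) - (?p \<bullet> ?q)\<^sup>2)"
    unfolding Zax det_2 inner_add_left inner_add_right inner_scaleR_left inner_scaleR_right
      inner_commute[of ?q ?p] by algebra
  then show ?thesis
    unfolding area_density_def D DZ Let_def by (simp add: o_apply real_sqrt_mult)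
qed

lemma area_density_cong:
  assumes "open U" "u \<in> U" "\<And>v. v \<in> U \<Longrightarrow> X v = Y v"
  shows "area_density X u = area_density Y u"
  using frechet_derivative_cong_open[OF assms] by (simp add: area_density_def)

text \<open>
  If the surface has one parametrization \<open>X\<close> with a linear left inverse \<open>q\<close>, then every other
  parametrization \<open>Y\<close> factors as \<open>X \<circ> (q \<circ> Y)\<close>, so that the change of variables formula for
  \<open>q \<circ> Y\<close> identifies the number that \<open>map_area\<close> selects.
\<close>

lemma map_area_eq_nn_integral:
  fixes X :: "real^2 \<Rightarrow> 'a::euclidean_space"
  assumes X: "local_parametrization S UNIV X" and S: "range X = S"
    and q: "bounded_linear q" "\<And>u. q (X u) = u"
    and GX: "\<And>u. (G \<circ> X) differentiable (at u)" and cont: "continuous_on UNIV (area_density (G \<circ> X))"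
    and A: "A \<subseteq> S" "X -` A \<in> sets borel"
  shows "map_area S G A = (\<integral>\<^sup>+u\<in>X -` A. ennreal (area_density (G \<circ> X) u) \<partial>lborel)"
  unfolding map_area_def
proof (rule the_equality)
  let ?I = "\<integral>\<^sup>+u\<in>X -` A. ennreal (area_density (G \<circ> X) u) \<partial>lborel"
  \<comment> \<open>Existence is shown by the trivial cutting: piece 0 is all of \<open>A\<close>
    and the others are empty.\<close>
  let ?D = "\<lambda>i::nat. if i = 0 then X -` A else {}"
  have "(\<Sum>i. \<integral>\<^sup>+u\<in>?D i. ennreal (area_density (G \<circ> X) u) \<partial>lborel) = ?I"
    by (subst suminf_finite[of "{0}"]) auto
  moreover have "(\<Union>i. X ` ?D i) = A" "disjoint_family (\<lambda>i. X ` ?D i)"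
    using A S by (auto simp: disjoint_family_on_def split: if_splits)
  ultimately show "\<exists>U Xa D. (\<forall>i::nat. local_parametrization S (U i) (Xa i) \<and> D i \<in> sets borel \<and> D i \<subseteq> U i) \<and>
      disjoint_family (\<lambda>i. Xa i ` D i) \<and> (\<Union>i. Xa i ` D i) = A \<and>
      ?I = (\<Sum>i. \<integral>\<^sup>+u\<in>D i. ennreal (area_density (G \<circ> Xa i) u) \<partial>lborel)"
    using X A by (intro exI[of _ "\<lambda>_. UNIV"] exI[of _ "\<lambda>_. X"] exI[of _ ?D]) auto
next
  fix a
  assume "\<exists>U Xa D. (\<forall>i::nat. local_parametrization S (U i) (Xa i) \<and> D i \<in> sets borel \<and> D i \<subseteq> U i) \<and>
      disjoint_family (\<lambda>i. Xa i ` D i) \<and> (\<Union>i. Xa i ` D i) = A \<and>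
      a = (\<Sum>i. \<integral>\<^sup>+u\<in>D i. ennreal (area_density (G \<circ> Xa i) u) \<partial>lborel)"
  then obtain U Y D where *: "(\<forall>i::nat. local_parametrization S (U i) (Y i) \<and> D i \<in> sets borel \<and> D i \<subseteq> U i) \<and>
      disjoint_family (\<lambda>i. Y i ` D i) \<and> (\<Union>i. Y i ` D i) = A \<and>
      a = (\<Sum>i. \<integral>\<^sup>+u\<in>D i. ennreal (area_density (G \<circ> Y i) u) \<partial>lborel)"
    by (elim exE) (rule that)
  have Y: "local_parametrization S (U i) (Y i)" and D: "D i \<in> sets borel" "D i \<subseteq> U i" for i
    using * by blast+
  have disj: "disjoint_family (\<lambda>i. Y i ` D i)" and un: "(\<Union>i. Y i ` D i) = A"
    and a: "a = (\<Sum>i. \<integral>\<^sup>+u\<in>D i. ennreal (area_density (G \<circ> Y i) u) \<partial>lborel)"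
    using * by auto
  let ?f = "area_density (G \<circ> X)"
  have meas_f: "?f \<in> borel_measurable lebesgue" "?f \<in> borel_measurable lborel"
    using borel_measurable_continuous_onI[OF cont] by (auto intro: measurable_completion)
  define h where "h = (\<lambda>i u. q (Y i u))"
  have U: "open (U i)" "smooth_on (U i) (Y i)" "Y i ` U i \<subseteq> S" "inj_on (Y i) (U i)" for i
    using Y[of i] unfolding local_parametrization_def homeomorphism_def
    by (auto dest: openin_imp_subset intro: inj_on_inverseI)
  have Xh: "X (h i u) = Y i u" if "u \<in> U i" for i u
    using U(3)[of i] that S q(2) unfolding h_def by force
  define h' where "h' = (\<lambda>i u v. q (frechet_derivative (Y i) (at u) v))"
  have h: "(h i has_derivative h' i u) (at u)" if "u \<in> U i" for i u
    unfolding h_def h'_def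
    by (rule bounded_linear.has_derivative[OF q(1) smooth_on_has_derivative[OF U(2) that]])
  have inj_h: "inj_on (h i) (D i)" for i
    by (rule inj_onI) (metis D(2) Xh U(4) inj_on_def subset_iff)
  have D_leb: "D i \<in> sets lebesgue" for i using D(1)[of i] by auto
  \<comment> \<open>Only Lebesgue measurability of these images is derived, which is why the pieces
    are added up with \<open>lebesgue\<close> in place of \<open>lborel\<close>.\<close>
  have hD: "h i ` D i \<in> sets lebesgue" for i
  proof (rule differentiable_image_in_sets_lebesgue[OF D_leb])
    show "h i differentiable_on D i"
      unfolding differentiable_on_def
      by (metis D(2) differentiable_def h has_derivative_at_withinI subset_iff)
  qed simp
  have eq: "(\<integral>\<^sup>+u\<in>D i. ennreal (area_density (G \<circ> Y i) u) \<partial>lborel)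
      = (\<integral>\<^sup>+u\<in>h i ` D i. ennreal (?f u) \<partial>lborel)" for i
  proof -
    have "area_density (G \<circ> Y i) u = \<bar>det (matrix (h' i u))\<bar> * ?f (h i u)" if "u \<in> D i" for u
    proof -
      have u: "u \<in> U i" using D(2) that by blast
      have "area_density (G \<circ> Y i) u = area_density ((G \<circ> X) \<circ> h i) u"
        by (rule area_density_cong[OF U(1) u]) (simp add: Xh)
      also have "\<dots> = \<bar>det (matrix (h' i u))\<bar> * ?f (h i u)"
        using GX frechet_derivative_works by (intro area_density_compose h u) blast
      finally show ?thesis .
    qed
    then have "(\<integral>\<^sup>+u\<in>D i. ennreal (area_density (G \<circ> Y i) u) \<partial>lborel)
        = (\<integral>\<^sup>+u\<in>D i. ennreal (\<bar>det (matrix (h' i u))\<bar> * ?f (h i u)) \<partial>lborel)"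
      by (intro nn_integral_cong) (auto split: split_indicator)
    also have "\<dots> = (\<integral>\<^sup>+u\<in>h i ` D i. ennreal (?f u) \<partial>lborel)"
    proof (rule nn_integral_change_of_variables[OF D_leb _ inj_h area_density_nonneg])
      show "(h i has_derivative h' i u) (at u within D i)" if "u \<in> D i" for u
        using D(2) h has_derivative_at_withinI that by blast
      have "continuous_on (U i) (\<lambda>u. h' i u v)" for v
        unfolding h'_def
        by (intro bounded_linear.continuous_on[OF q(1)] smooth_on_imp_continuous_on
            smooth_on_frechet_derivative U)
      then have c1: "continuous_on (D i) (\<lambda>u. h' i u v)" for v
        using D(2) continuous_on_subset by blast
      have c2: "continuous_on (D i) (h i)"
        unfolding h_def
        by (intro bounded_linear.continuous_on[OF q(1)]
            continuous_on_subset[OF smooth_on_imp_continuous_on[OF U(2)] D(2)])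
      have "continuous_on (D i) (\<lambda>u. \<bar>det (matrix (h' i u))\<bar> * ?f (h i u))"
        unfolding det_2 matrix_def
        by (auto intro!: continuous_intros c1 continuous_on_compose2[OF cont c2])
      from borel_measurable_continuous_on_indicator[OF D(1) this]
      show "(\<lambda>u. indicator (D i) u * (\<bar>det (matrix (h' i u))\<bar> * ?f (h i u))) \<in> borel_measurable lebesgue"
        by (auto intro: measurable_completion)
      show "(\<lambda>u. indicator (h i ` D i) u * ?f u) \<in> borel_measurable lebesgue"
        using hD meas_f by (intro borel_measurable_times borel_measurable_indicator) auto
    qed
    finally show ?thesis .
  qed
  have hXA: "(\<Union>i. h i ` D i) = X -` A"
  proof (intro set_eqI iffI)
    fix u assume "u \<in> (\<Union>i. h i ` D i)"
    then obtain i v where "v \<in> D i" "u = h i v" by auto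
    then have "X u = Y i v" using Xh D(2) by blast
    then show "u \<in> X -` A" using un \<open>v \<in> D i\<close> by blast
  next
    fix u assume "u \<in> X -` A"
    then obtain i v where v: "v \<in> D i" "X u = Y i v" using un by auto
    then have "u = h i v" using q(2)[of u] by (simp add: h_def)
    then show "u \<in> (\<Union>i. h i ` D i)" using v by auto
  qed
  have disj_h: "disjoint_family (\<lambda>i. h i ` D i)"
    unfolding disjoint_family_on_def
  proof (intro ballI impI)
    fix i j :: nat assume "i \<noteq> j"
    then have *: "Y i ` D i \<inter> Y j ` D j = {}" using disj by (auto simp: disjoint_family_on_def)
    have "X w \<in> Y k ` D k" if "w \<in> h k ` D k" for w k
      using that Xh D(2)[of k] by auto
    then show "h i ` D i \<inter> h j ` D j = {}" using * by blast
  qed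
  have "a = (\<Sum>i. emeasure (density lebesgue (\<lambda>u. ennreal (?f u))) (h i ` D i))"
    unfolding a eq using hD meas_f
    by (subst emeasure_density) (auto simp: nn_integral_completion)
  also have "\<dots> = emeasure (density lebesgue (\<lambda>u. ennreal (?f u))) (X -` A)"
    unfolding hXA[symmetric] using hD disj_h by (intro suminf_emeasure) auto
  also have "\<dots> = (\<integral>\<^sup>+u\<in>X -` A. ennreal (?f u) \<partial>lborel)"
    using A(2) meas_f by (subst emeasure_density) (auto simp: nn_integral_completion)
  finally show "a = (\<integral>\<^sup>+u\<in>X -` A. ennreal (?f u) \<partial>lborel)" .
qed

section \<open>Graphs of entire functions\<close>

definition complex_of_vec :: "real^2 \<Rightarrow> complex" where
  "complex_of_vec u = Complex (u $ 1) (u $ 2)"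

definition vec_of_complex :: "complex \<Rightarrow> real^2" where
  "vec_of_complex z = vector [Re z, Im z]"

lemma complex_of_vec_of_complex [simp]: "complex_of_vec (vec_of_complex z) = z"
  by (simp add: complex_of_vec_def vec_of_complex_def)

lemma vec_of_complex_of_vec [simp]: "vec_of_complex (complex_of_vec u) = u"
  by (simp add: complex_of_vec_def vec_of_complex_def vec_eq_iff forall_2)

lemma complex_of_vec_axis [simp]:
  "complex_of_vec (axis 1 1) = 1" "complex_of_vec (axis 2 1) = \<i>"
  by (simp_all add: complex_of_vec_def axis_def complex_eq_iff)

lemma bounded_linear_complex_of_vec: "bounded_linear complex_of_vec"
  by (rule linear_conv_bounded_linear[THEN iffD1], rule linearI)
    (simp_all add: complex_of_vec_def complex_eq_iff)

lemma bounded_linear_vec_of_complex: "bounded_linear vec_of_complex"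
  by (rule linear_conv_bounded_linear[THEN iffD1], rule linearI)
    (simp_all add: vec_of_complex_def vec_eq_iff forall_2)

text \<open>The complex structure of C^2; the bilinear form \<open>J p \<bullet> q\<close> is the
  Kaehler form.\<close>

definition J :: "complex \<times> complex \<Rightarrow> complex \<times> complex" where
  "J p = (\<i> * fst p, \<i> * snd p)"

lemma bounded_linear_J: "bounded_linear J"
  unfolding J_def
  by (intro bounded_linear_Pair bounded_linear_const_mult bounded_linear_fst bounded_linear_snd)

lemma J_inner_J [simp]: "J p \<bullet> J q = p \<bullet> q"
  by (simp add: J_def inner_prod_def inner_complex_def)

lemma J_inner_commute: "J p \<bullet> q = - (J q \<bullet> p)"
  by (simp add: J_def inner_prod_def inner_complex_def)

lemma J_inner_self [simp]: "J p \<bullet> p = 0" "p \<bullet> J p = 0"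
  using J_inner_commute[of p p] by (auto simp: inner_commute)

text \<open>Bessel's inequality for the orthogonal vectors \<open>a\<close> and \<open>J a\<close> of equal length.\<close>

lemma wirtinger_inequality: "J a \<bullet> b \<le> sqrt ((a \<bullet> a) * (b \<bullet> b) - (a \<bullet> b)\<^sup>2)"
proof -
  define s where "s = (J a \<bullet> b)\<^sup>2 + (a \<bullet> b)\<^sup>2"
  \<comment> \<open>\<open>w\<close> is \<open>a \<bullet> a\<close> times the orthogonal projection
    of \<open>b\<close> to the span of \<open>a\<close> and \<open>J a\<close>; the Cauchy-Schwarz
    inequality for \<open>w\<close> and \<open>b\<close> yields the bound on
    \<open>s\<close>.\<close>
  define w where "w = (J a \<bullet> b) *\<^sub>R J a + (a \<bullet> b) *\<^sub>R a"
  have "w \<bullet> b = s" by (simp add: w_def s_def inner_add_left power2_eq_square)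
  moreover have "w \<bullet> w = (a \<bullet> a) * s"
    by (simp add: w_def s_def inner_add_left inner_add_right power2_eq_square algebra_simps)
  ultimately have "s * s \<le> ((a \<bullet> a) * (b \<bullet> b)) * s"
    using Cauchy_Schwarz_ineq[of w b] by (simp add: power2_eq_square mult_ac)
  moreover have "s \<ge> 0" by (simp add: s_def)
  ultimately have "s \<le> (a \<bullet> a) * (b \<bullet> b)"
    by (cases "s = 0") (auto simp: mult_le_cancel_right)
  then show ?thesis unfolding s_def by (intro real_le_rsqrt) simp
qed

lemma has_derivative_slice:
  assumes "(F has_derivative F') (at (t, u))"
  shows "((\<lambda>u. F (t, u)) has_derivative (\<lambda>v. F' (0, v))) (at u)"
  by (rule has_derivative_compose[where g=F and f="\<lambda>u. (t, u)", OF _ assms])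
    (auto intro!: derivative_eq_intros)

section \<open>The graph as a conformally parametrized surface\<close>

locale holomorphic_graph =
  fixes f :: "complex \<Rightarrow> complex"
  assumes holomorphic: "f holomorphic_on UNIV"
begin

definition X :: "real^2 \<Rightarrow> complex \<times> complex" where
  "X u = (complex_of_vec u, f (complex_of_vec u))"

definition X\<^sub>1 :: "real^2 \<Rightarrow> complex \<times> complex" where
  "X\<^sub>1 u = (1, deriv f (complex_of_vec u))"

lemma range_X: "range X = {(z, f z) | z. z \<in> UNIV}"
proof -
  have "(z, f z) \<in> range X" for z
    by (rule range_eqI[of _ _ "vec_of_complex z"]) (simp add: X_def)
  moreover have "range X \<subseteq> {(z, f z) | z. z \<in> UNIV}" by (auto simp: X_def)
  ultimately show ?thesis by blast
qed

lemma left_inverse_X: "vec_of_complex (fst (X u)) = u"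
  by (simp add: X_def)

lemma bounded_linear_left_inverse_X:
  "bounded_linear (\<lambda>p. vec_of_complex (fst (p :: complex \<times> complex)))"
  by (rule bounded_linear_compose[OF bounded_linear_vec_of_complex bounded_linear_fst])

lemma has_derivative_holomorphic:
  assumes "g holomorphic_on UNIV"
  shows "((\<lambda>u. g (complex_of_vec u)) has_derivative
    (\<lambda>v. deriv g (complex_of_vec u) * complex_of_vec v)) (at u)"
proof -
  have "(g has_derivative (\<lambda>h. deriv g (complex_of_vec u) * h)) (at (complex_of_vec u))"
    using holomorphic_derivI[OF assms open_UNIV] by (simp add: has_field_derivative_def)
  from has_derivative_compose[OF bounded_linear_imp_has_derivative[OF bounded_linear_complex_of_vec] this]
  show ?thesis .
qed

lemma has_derivative_X:
  "(X has_derivative (\<lambda>v. (complex_of_vec v, deriv f (complex_of_vec u) * complex_of_vec v))) (at u)"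
  unfolding X_def
  by (intro has_derivative_Pair has_derivative_holomorphic holomorphic
      bounded_linear_imp_has_derivative bounded_linear_complex_of_vec)

text \<open>The derivative is complex linear, so the direction \<i> gives \<open>J\<close> of the
  direction 1. This makes the Kaehler form and the area density of \<open>X\<close> agree.\<close>

lemma frechet_derivative_X:
  "frechet_derivative X (at u) (axis 1 1) = X\<^sub>1 u" "frechet_derivative X (at u) (axis 2 1) = J (X\<^sub>1 u)"
  by (simp_all add: frechet_derivative_eqI[OF has_derivative_X] X\<^sub>1_def J_def)

text \<open>Pairs of entire functions are closed under directional derivatives: differentiation
  along \<open>v\<close> multiplies the complex derivatives by the constant
  \<open>complex_of_vec v\<close>.\<close>

lemma smooth_on_X: "smooth_on UNIV X"
proof -
  define P where "P = (\<lambda>g :: real^2 \<Rightarrow> complex \<times> complex. \<exists>g1 g2. g1 holomorphic_on UNIV \<and>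
    g2 holomorphic_on UNIV \<and> g = (\<lambda>u. (g1 (complex_of_vec u), g2 (complex_of_vec u))))"
  have "P X"
    unfolding P_def X_def using holomorphic
    by (intro exI[of _ "\<lambda>z. z"] exI[of _ f]) auto
  then show ?thesis
  proof (rule smooth_on_coinduct)
    fix g assume "P g"
    then obtain g1 g2 where g: "g1 holomorphic_on UNIV" "g2 holomorphic_on UNIV"
      "g = (\<lambda>u. (g1 (complex_of_vec u), g2 (complex_of_vec u)))" unfolding P_def by blast
    let ?g' = "\<lambda>u v. (deriv g1 (complex_of_vec u) * complex_of_vec v, deriv g2 (complex_of_vec u) * complex_of_vec v)"
    have "(g has_derivative ?g' u) (at u)" for u
      unfolding g(3) by (intro has_derivative_Pair has_derivative_holomorphic g)
    moreover have "P (\<lambda>u. ?g' u v)" for v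
      unfolding P_def
      by (intro exI[of _ "\<lambda>z. deriv g1 z * complex_of_vec v"] exI[of _ "\<lambda>z. deriv g2 z * complex_of_vec v"]
          conjI holomorphic_intros g open_UNIV refl)
    ultimately show "\<exists>g'. (\<forall>u\<in>UNIV. (g has_derivative g' u) (at u)) \<and> (\<forall>v. P (\<lambda>u. g' u v))"
      by (intro exI[of _ ?g']) auto
  qed simp
qed

lemma continuous_on_X: "continuous_on A X"
  using smooth_on_imp_continuous_on[OF smooth_on_X] continuous_on_subset by blast

text \<open>The first component of \<open>X\<close> identifies the plane with the complex line.
  Hence the derivative is injective, and projection to that component inverts \<open>X\<close>
  globally.\<close>

lemma local_parametrization_X: "local_parametrization (range X) UNIV X"
  unfolding local_parametrization_def
proof (intro conjI ballI)
  show "inj (frechet_derivative X (at u))" for u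
  proof (rule injI)
    fix v w assume "frechet_derivative X (at u) v = frechet_derivative X (at u) w"
    then have "complex_of_vec v = complex_of_vec w"
      by (simp add: frechet_derivative_eqI[OF has_derivative_X])
    then show "v = w" by (metis vec_of_complex_of_vec)
  qed
  show "\<exists>q. homeomorphism UNIV (range X) X q"
    by (intro exI[of _ "\<lambda>p. vec_of_complex (fst p)"] homeomorphismI continuous_on_X
        linear_continuous_on bounded_linear_left_inverse_X) (auto simp: left_inverse_X)
qed (auto intro: smooth_on_X)

lemma smooth_surface_graph: "smooth_surface (range X)"
  unfolding smooth_surface_def using local_parametrization_X by blast

text \<open>On the graph the inverse of \<open>X\<close> is the restriction of a linear map, so the
  preimage is a continuous image of \<open>K\<close>.\<close>

lemma vimage_X_compact:
  assumes "compact K" "K \<subseteq> range X"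
  shows "compact (X -` K)"
proof -
  have "X -` K = (\<lambda>p. vec_of_complex (fst p)) ` K"
  proof (intro set_eqI iffI)
    fix u assume "u \<in> X -` K"
    then show "u \<in> (\<lambda>p. vec_of_complex (fst p)) ` K"
      by (intro image_eqI[of _ _ "X u"]) (auto simp: left_inverse_X)
  qed (use assms(2) left_inverse_X in auto)
  then show ?thesis
    using compact_continuous_image[OF linear_continuous_on[OF bounded_linear_left_inverse_X] assms(1)]
    by simp
qed

text \<open>\<open>X\<close> is conformal: its two partial derivatives are orthogonal and of equal
  length.\<close>

lemma area_density_X: "area_density X u = X\<^sub>1 u \<bullet> X\<^sub>1 u"
  unfolding area_density_def frechet_derivative_X Let_def by simp

lemma map_area_graph:
  assumes "\<And>u. (G \<circ> X) differentiable (at u)" "continuous_on UNIV (area_density (G \<circ> X))"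
    and "A \<subseteq> range X" "X -` A \<in> sets borel"
  shows "map_area (range X) G A = (\<integral>\<^sup>+u\<in>X -` A. ennreal (area_density (G \<circ> X) u) \<partial>lborel)"
  by (rule map_area_eq_nn_integral[OF local_parametrization_X refl
        bounded_linear_left_inverse_X left_inverse_X assms])

end

section \<open>Variations of the graph\<close>

text \<open>\<open>F (t, u) = \<Phi> t (X u)\<close> for a variation \<open>\<Phi>\<close> of the graph, with \<open>K = X -` (support)\<close>.\<close>

locale graph_variation = holomorphic_graph +
  fixes F :: "real \<times> (real^2) \<Rightarrow> complex \<times> complex" and \<epsilon> :: real and K :: "(real^2) set" and l r :: "real^2"
  assumes eps: "\<epsilon> > 0" and smooth_F: "smooth_on ({-\<epsilon><..<\<epsilon>} \<times> UNIV) F"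
    and F_0: "\<And>u. F (0, u) = X u"
    and F_outside: "\<And>t u. \<bar>t\<bar> < \<epsilon> \<Longrightarrow> u \<notin> K \<Longrightarrow> F (t, u) = X u"
    and compact_K: "compact K" and K_box: "K \<subseteq> cbox l r"
begin

section \<open>Derivatives, Gram determinant and Kaehler form along a variation\<close>

abbreviation W :: "(real \<times> (real^2)) set" where "W \<equiv> {-\<epsilon><..<\<epsilon>} \<times> UNIV"

lemma open_W: "open W"
  by (intro open_Times) auto

lemma in_W: "\<bar>t\<bar> < \<epsilon> \<Longrightarrow> (t, u) \<in> W"
  by auto

definition a :: "real \<times> (real^2) \<Rightarrow> complex \<times> complex" where
  "a p = frechet_derivative F (at p) (0, axis 1 1)"

definition b :: "real \<times> (real^2) \<Rightarrow> complex \<times> complex" where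
  "b p = frechet_derivative F (at p) (0, axis 2 1)"

text \<open>The determinant \<open>E G - F\<^sup>2\<close> of the induced metric. It is kept without
  the root because it is smooth even where a slice stops being an immersion.\<close>

definition gram :: "real \<times> (real^2) \<Rightarrow> real" where
  "gram p = (a p \<bullet> a p) * (b p \<bullet> b p) - (a p \<bullet> b p) * (a p \<bullet> b p)"

lemma smooth_a: "smooth_on W a" and smooth_b: "smooth_on W b"
  unfolding a_def[abs_def] b_def[abs_def]
  by (rule smooth_on_frechet_derivative[OF smooth_F])+

lemma smooth_gram: "smooth_on W gram"
  unfolding gram_def[abs_def]
  by (intro smooth_on_diff smooth_on_mult smooth_on_inner smooth_a smooth_b open_W)

lemma slice_derivative:
  "\<bar>t\<bar> < \<epsilon> \<Longrightarrow> ((\<lambda>u. F (t, u)) has_derivative (\<lambda>v. frechet_derivative F (at (t, u)) (0, v))) (at u)"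
  by (rule has_derivative_slice[OF smooth_on_has_derivative[OF smooth_F in_W]])

lemma slice_frechet_derivative:
  assumes "\<bar>t\<bar> < \<epsilon>"
  shows "frechet_derivative (\<lambda>u. F (t, u)) (at u) (axis 1 1) = a (t, u)"
    "frechet_derivative (\<lambda>u. F (t, u)) (at u) (axis 2 1) = b (t, u)"
  by (simp_all add: frechet_derivative_eqI[OF slice_derivative[OF assms]] a_def b_def)

lemma area_density_slice: "\<bar>t\<bar> < \<epsilon> \<Longrightarrow> area_density (\<lambda>u. F (t, u)) u = sqrt (gram (t, u))"
  unfolding area_density_def Let_def gram_def slice_frechet_derivative power2_eq_square by (rule refl)

lemma a_0: "a (0, u) = X\<^sub>1 u" and b_0: "b (0, u) = J (X\<^sub>1 u)"
  using slice_frechet_derivative[of 0 u] eps by (simp_all add: F_0 frechet_derivative_X)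

text \<open>On the open complement of \<open>K\<close> the slice at time \<open>t\<close> coincides
  with the initial one, and so do the derivatives.\<close>

lemma a_outside: "\<bar>t\<bar> < \<epsilon> \<Longrightarrow> u \<notin> K \<Longrightarrow> a (t, u) = a (0, u)"
  and b_outside: "\<bar>t\<bar> < \<epsilon> \<Longrightarrow> u \<notin> K \<Longrightarrow> b (t, u) = b (0, u)"
proof -
  assume t: "\<bar>t\<bar> < \<epsilon>" and u: "u \<notin> K"
  have "frechet_derivative (\<lambda>u. F (t, u)) (at u) = frechet_derivative (\<lambda>u. F (0, u)) (at u)"
    using compact_K u F_outside[OF t] F_0
    by (intro frechet_derivative_cong_open[of "- K"]) (auto simp: compact_imp_closed open_Compl)
  then show "a (t, u) = a (0, u)" "b (t, u) = b (0, u)"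
    using slice_frechet_derivative[OF t] slice_frechet_derivative[of 0] eps by (metis abs_zero)+
qed

lemma gram_0: "gram (0, u) = (X\<^sub>1 u \<bullet> X\<^sub>1 u)\<^sup>2" "gram (0, u) > 0"
proof -
  show "gram (0, u) = (X\<^sub>1 u \<bullet> X\<^sub>1 u)\<^sup>2" by (simp add: gram_def a_0 b_0 power2_eq_square)
  moreover have "X\<^sub>1 u \<noteq> 0" by (simp add: X\<^sub>1_def zero_prod_def)
  ultimately show "gram (0, u) > 0" by simp
qed

text \<open>The pullback of the Kaehler form by a time slice, evaluated on the two coordinate
  directions.\<close>

definition \<omega> :: "real \<times> (real^2) \<Rightarrow> real" where "\<omega> p = J (a p) \<bullet> b p"

lemma \<omega>_le_sqrt_gram: "\<omega> p \<le> sqrt (gram p)"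
  using wirtinger_inequality[of "a p" "b p"] by (simp add: \<omega>_def gram_def power2_eq_square)

lemma \<omega>_0: "\<omega> (0, u) = sqrt (gram (0, u))"
  unfolding gram_0(1) by (simp add: \<omega>_def a_0 b_0)

lemma smooth_\<omega>: "smooth_on W \<omega>"
  unfolding \<omega>_def[abs_def]
  by (rule smooth_on_inner[OF open_W smooth_on_bounded_linear[OF open_W bounded_linear_J smooth_a] smooth_b])

lemma continuous_on_slice:
  assumes "smooth_on W g" "\<bar>t\<bar> < \<epsilon>"
  shows "continuous_on A (\<lambda>u. g (t, u))"
  by (rule continuous_on_compose2[OF smooth_on_imp_continuous_on[OF assms(1)]])
    (use assms(2) in \<open>auto intro: continuous_on_Pair continuous_on_const continuous_on_id\<close>)

section \<open>The calibration argument: Stokes' theorem and the second variation of area\<close>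

text \<open>
  Stokes' theorem: \<open>2 \<omega> = \<partial>\<^sub>1 (J F \<bullet> \<partial>\<^sub>2 F) - \<partial>\<^sub>2 (J F \<bullet> \<partial>\<^sub>1 F)\<close>, and both functions under the
  derivatives keep their values outside \<open>K\<close>.
\<close>

lemma integral_\<omega>_eq:
  assumes t: "\<bar>t\<bar> < \<epsilon>"
  shows "integral (cbox l r) (\<lambda>u. \<omega> (t, u)) = integral (cbox l r) (\<lambda>u. \<omega> (0, u))"
proof -
  \<comment> \<open>Twice the Kaehler form is the differential of the one-form
    \<open>J p \<bullet> dp\<close>; \<open>M1\<close> and \<open>M2\<close> are the coefficients of
    its pullback by a slice.\<close>
  define M1 where "M1 = (\<lambda>p. J (F p) \<bullet> a p)"
  define M2 where "M2 = (\<lambda>p. J (F p) \<bullet> b p)"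
  have M: "smooth_on W M1" "smooth_on W M2"
    unfolding M1_def M2_def
    by (rule smooth_on_inner[OF open_W smooth_on_bounded_linear[OF open_W bounded_linear_J smooth_F]],
        rule smooth_a smooth_b)+
  \<comment> \<open>The coefficients need not have compact support, but their change since time 0
    vanishes outside \<open>K\<close>; so the difference of the two times is integrated.\<close>
  have zero: "integral (cbox l r) (\<lambda>u. frechet_derivative M (at (t, u)) (0, v) - frechet_derivative M (at (0, u)) (0, v)) = 0"
    if M: "smooth_on W M" and out: "\<And>u. u \<notin> K \<Longrightarrow> M (t, u) = M (0, u)" for M :: "_ \<Rightarrow> real" and v
  proof (rule integral_directional_derivative_eq_0[OF compact_imp_closed[OF compact_K] K_box])
    show "((\<lambda>u. M (t, u) - M (0, u)) has_derivative
        (\<lambda>v. frechet_derivative M (at (t, u)) (0, v) - frechet_derivative M (at (0, u)) (0, v))) (at u)" for u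
      by (intro has_derivative_diff has_derivative_slice smooth_on_has_derivative[OF M] in_W t)
        (simp add: eps)
    show "continuous_on UNIV (\<lambda>u. frechet_derivative M (at (t, u)) (0, v) - frechet_derivative M (at (0, u)) (0, v))"
      using eps by (intro continuous_on_diff continuous_on_slice smooth_on_frechet_derivative M t) simp
    show "M (t, u) - M (0, u) = 0" if "u \<notin> K" for u using out[OF that] by simp
  qed
  have z1: "integral (cbox l r) (\<lambda>u. frechet_derivative M1 (at (t, u)) (0, axis 2 1) - frechet_derivative M1 (at (0, u)) (0, axis 2 1)) = 0"
    by (rule zero[OF M(1)]) (simp add: M1_def a_outside[OF t] F_outside[OF t] F_0)
  have z2: "integral (cbox l r) (\<lambda>u. frechet_derivative M2 (at (t, u)) (0, axis 1 1) - frechet_derivative M2 (at (0, u)) (0, axis 1 1)) = 0"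
    by (rule zero[OF M(2)]) (simp add: M2_def b_outside[OF t] F_outside[OF t] F_0)
  have d\<omega>: "frechet_derivative M2 (at (s, u)) (0, axis 1 1) - frechet_derivative M1 (at (s, u)) (0, axis 2 1) = 2 * \<omega> (s, u)"
    if "\<bar>s\<bar> < \<epsilon>" for s u
  proof -
    let ?p = "(s, u)"
    note p = in_W[OF that, of u]
    note JF = bounded_linear.has_derivative[OF bounded_linear_J smooth_on_has_derivative[OF smooth_F p]]
    have 1: "frechet_derivative M1 (at ?p) (0, axis 2 1) =
        J (F ?p) \<bullet> frechet_derivative a (at ?p) (0, axis 2 1) + J (b ?p) \<bullet> a ?p"
      unfolding M1_def b_def
      by (rule frechet_derivative_eqI[OF has_derivative_inner[OF JF smooth_on_has_derivative[OF smooth_a p]]])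
    have 2: "frechet_derivative M2 (at ?p) (0, axis 1 1) =
        J (F ?p) \<bullet> frechet_derivative b (at ?p) (0, axis 1 1) + J (a ?p) \<bullet> b ?p"
      unfolding M2_def a_def
      by (rule frechet_derivative_eqI[OF has_derivative_inner[OF JF smooth_on_has_derivative[OF smooth_b p]]])
    \<comment> \<open>Symmetry of second derivatives cancels the terms with \<open>J (F ?p)\<close>,
      and antisymmetry of the Kaehler form doubles what is left.\<close>
    have "frechet_derivative b (at ?p) (0, axis 1 1) = frechet_derivative a (at ?p) (0, axis 2 1)"
      unfolding a_def[abs_def] b_def[abs_def]
      using smooth_F open_W p by (intro second_derivative_symmetric[of W]) (auto simp: smooth_on_def)
    then show ?thesis using J_inner_commute[of "b ?p" "a ?p"]
      unfolding 1 2 \<omega>_def by (simp add: inner_commute)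
  qed
  have int: "(\<lambda>u. g (s, u)) integrable_on cbox l r" if "smooth_on W g" "\<bar>s\<bar> < \<epsilon>"
    for g :: "_ \<Rightarrow> real" and s
    by (intro integrable_continuous continuous_on_slice that)
  note ints = int[OF smooth_on_frechet_derivative[OF M(1)]] int[OF smooth_on_frechet_derivative[OF M(2)]]
  have e0: "\<bar>0\<bar> < \<epsilon>" using eps by simp
  have "2 * (integral (cbox l r) (\<lambda>u. \<omega> (t, u)) - integral (cbox l r) (\<lambda>u. \<omega> (0, u)))
    = integral (cbox l r) (\<lambda>u. 2 * \<omega> (t, u)) - integral (cbox l r) (\<lambda>u. 2 * \<omega> (0, u))"
    by (simp add: right_diff_distrib)
  also have "\<dots> = integral (cbox l r) (\<lambda>u. frechet_derivative M2 (at (t, u)) (0, axis 1 1) - frechet_derivative M2 (at (0, u)) (0, axis 1 1))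
    - integral (cbox l r) (\<lambda>u. frechet_derivative M1 (at (t, u)) (0, axis 2 1) - frechet_derivative M1 (at (0, u)) (0, axis 2 1))"
    unfolding d\<omega>[OF t, symmetric] d\<omega>[OF e0, symmetric]
    by (simp add: integral_diff ints t eps)
  finally show ?thesis unfolding z1 z2 by simp
qed

text \<open>Positivity at time 0 is an open condition, and the tube lemma makes it uniform over the
  compact box. It is what allows the square root to be differentiated.\<close>

lemma gram_pos_near_0: "\<exists>\<delta>>0. \<delta> \<le> \<epsilon> \<and> (\<forall>t u. \<bar>t\<bar> < \<delta> \<longrightarrow> u \<in> cbox l r \<longrightarrow> gram (t, u) > 0)"
proof -
  have "open {p \<in> W. gram p > 0}"
    using continuous_open_preimage[OF smooth_on_imp_continuous_on[OF smooth_gram] open_W open_greaterThan[of 0]]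
    by (simp add: vimage_def Int_def)
  moreover have "{0} \<times> cbox l r \<subseteq> {p \<in> W. gram p > 0}" using gram_0(2) eps by auto
  ultimately have "\<exists>T. 0 \<in> T \<and> open T \<and> T \<times> cbox l r \<subseteq> {p \<in> W. gram p > 0}"
    by (rule Elementary_Topology.tube_lemma[OF compact_cbox])
  then obtain T where T: "0 \<in> T" "open T" "T \<times> cbox l r \<subseteq> {p \<in> W. gram p > 0}"
    by (elim exE conjE) (rule that)
  obtain d where d: "d > 0" "ball 0 d \<subseteq> T"
    using openE[OF T(2,1)] by blast
  have "gram (t, u) > 0" if "\<bar>t\<bar> < min d \<epsilon>" "u \<in> cbox l r" for t u
  proof -
    have "t \<in> T" using d(2) that by (auto simp: subset_iff)
    then have "(t, u) \<in> {p \<in> W. gram p > 0}" using T(3) that(2) by blast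
    then show ?thesis by simp
  qed
  then show ?thesis
    using d(1) eps by (intro exI[of _ "min d \<epsilon>"]) auto
qed

definition K_area :: "real \<Rightarrow> real" where
  "K_area t = integral K (\<lambda>u. sqrt (gram (t, u)))"

text \<open>Over the box, Leibniz's rule gives the derivatives and the calibration makes time 0 a
  minimum. Passing from the box to \<open>K\<close> changes the area by a constant, as the variation
  is fixed outside \<open>K\<close>.\<close>

lemma K_area_second_variation:
  "\<exists>\<delta>>0. \<exists>A' d. (\<forall>t. \<bar>t\<bar> < \<delta> \<longrightarrow> (K_area has_real_derivative A' t) (at t)) \<and>
     (A' has_real_derivative d) (at 0) \<and> A' 0 = 0 \<and> 0 \<le> d"
proof -
  obtain \<delta> where \<delta>: "\<delta> > 0" "\<delta> \<le> \<epsilon>"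
    and pos: "\<And>t u. \<bar>t\<bar> < \<delta> \<Longrightarrow> u \<in> cbox l r \<Longrightarrow> gram (t, u) > 0"
    using gram_pos_near_0 by blast
  \<comment> \<open>The square root is written as a power so that \<open>smooth_on_powr\<close>
    applies where \<open>gram\<close> is positive.\<close>
  define \<sigma> where "\<sigma> = (\<lambda>p. gram p powr (1/2))"
  let ?W = "{p \<in> W. gram p > 0}"
  have "open ?W"
    using continuous_open_preimage[OF smooth_on_imp_continuous_on[OF smooth_gram] open_W open_greaterThan[of 0]]
    by (simp add: vimage_def Int_def)
  then have \<sigma>: "smooth_on ?W \<sigma>"
    unfolding \<sigma>_def by (intro smooth_on_powr smooth_on_subset[OF smooth_gram]) auto
  have sub: "{-\<delta><..<\<delta>} \<times> cbox l r \<subseteq> ?W" using pos \<delta> by auto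
  define A where "A = (\<lambda>t. integral (cbox l r) (\<lambda>u. \<sigma> (t, u)))"
  define A' where "A' = (\<lambda>t. integral (cbox l r) (\<lambda>u. frechet_derivative \<sigma> (at (t, u)) (1, 0)))"
  have A: "(A has_real_derivative A' t) (at t)" if "\<bar>t\<bar> < \<delta>" for t
    unfolding A_def A'_def by (rule has_real_derivative_integral_smooth[OF \<sigma> sub that])
  obtain d where d: "(A' has_real_derivative d) (at 0)"
    using has_real_derivative_integral_smooth[OF smooth_on_frechet_derivative[OF \<sigma>] sub, of 0] \<delta>
    unfolding A'_def by auto
  have \<sigma>_eq: "\<sigma> (t, u) = sqrt (gram (t, u))" if "\<bar>t\<bar> < \<delta>" "u \<in> cbox l r" for t u
    using pos[OF that] by (simp add: \<sigma>_def powr_half_sqrt)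
  have cont_\<sigma>: "continuous_on (cbox l r) (\<lambda>u. \<sigma> (t, u))" if "\<bar>t\<bar> < \<delta>" for t
    by (rule continuous_on_compose2[OF smooth_on_imp_continuous_on[OF \<sigma>]])
      (use pos[OF that] that \<delta> in \<open>auto intro: continuous_on_Pair continuous_on_const continuous_on_id\<close>)
  have min: "A 0 \<le> A t" if t: "\<bar>t\<bar> < \<delta>" for t
  proof -
    have t': "\<bar>t\<bar> < \<epsilon>" using t \<delta> by simp
    \<comment> \<open>Calibration: equality holds at time 0, Stokes' theorem moves the integral to
      time \<open>t\<close>, and Wirtinger's inequality bounds it by the area.\<close>
    have "A 0 = integral (cbox l r) (\<lambda>u. \<omega> (0, u))"
      unfolding A_def using \<delta> by (intro integral_cong) (simp add: \<sigma>_eq \<omega>_0)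
    also have "\<dots> = integral (cbox l r) (\<lambda>u. \<omega> (t, u))" using integral_\<omega>_eq[OF t'] by simp
    also have "\<dots> \<le> A t"
      unfolding A_def
      by (intro integral_le integrable_continuous cont_\<sigma> t continuous_on_slice[OF smooth_\<omega> t'])
        (simp add: \<sigma>_eq t \<omega>_le_sqrt_gram)
    finally show ?thesis .
  qed
  note nonneg = local_min_second_derivative_nonneg[OF \<delta>(1) A d min]
  have K_area: "K_area t = A t + (K_area 0 - A 0)" if t: "\<bar>t\<bar> < \<delta>" for t
  proof -
    have K: "K \<in> sets lebesgue" using compact_K by (simp add: compact_imp_closed)
    have int: "(\<lambda>u. \<sigma> (t, u)) integrable_on K" if "\<bar>t\<bar> < \<delta>" for t
    proof -
      have "(\<lambda>u. \<sigma> (t, u)) absolutely_integrable_on cbox l r"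
        by (rule absolutely_integrable_continuous[OF cont_\<sigma>[OF that]])
      then show ?thesis
        using set_integrable_subset[OF _ K K_box] set_lebesgue_integral_eq_integral(1) by blast
    qed
    have K_area_eq: "K_area t = integral K (\<lambda>u. \<sigma> (t, u))" if "\<bar>t\<bar> < \<delta>" for t
      unfolding K_area_def using K_box that by (intro integral_cong) (auto simp: \<sigma>_eq)
    \<comment> \<open>Since nothing changes outside \<open>K\<close>, the integrals of this
      difference over \<open>K\<close> and over the box agree.\<close>
    have outside: "\<sigma> (t, u) - \<sigma> (0, u) = 0" if "u \<notin> K" for u
      using a_outside[of t u] b_outside[of t u] t \<delta> that by (simp add: \<sigma>_def gram_def)
    have "((\<lambda>u. \<sigma> (t, u) - \<sigma> (0, u)) has_integral K_area t - K_area 0) K"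
      using K_area_eq[OF t] K_area_eq[of 0] \<delta> int[OF t] int[of 0]
      by (auto intro!: has_integral_diff integrable_integral)
    then have "((\<lambda>u. \<sigma> (t, u) - \<sigma> (0, u)) has_integral K_area t - K_area 0) (cbox l r)"
      using outside K_box by (rule has_integral_on_superset)
    moreover have "((\<lambda>u. \<sigma> (t, u) - \<sigma> (0, u)) has_integral A t - A 0) (cbox l r)"
      unfolding A_def using \<delta>(1)
      by (intro has_integral_diff integrable_integral integrable_continuous cont_\<sigma> t) auto
    ultimately have "K_area t - K_area 0 = A t - A 0" by (rule has_integral_unique)
    then show ?thesis by simp
  qed
  have "(K_area has_real_derivative A' t) (at t)" if "\<bar>t\<bar> < \<delta>" for t
  proof (rule has_field_derivative_transform_within_open[of "\<lambda>t. A t + (K_area 0 - A 0)" _ _ "{-\<delta><..<\<delta>}"])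
    show "((\<lambda>t. A t + (K_area 0 - A 0)) has_real_derivative A' t) (at t)"
      using DERIV_add[OF A[OF that] DERIV_const] by simp
    show "A t + (K_area 0 - A 0) = K_area t" if "t \<in> {-\<delta><..<\<delta>}" for t
      using K_area[of t] that by auto
  qed (use that in auto)
  then show ?thesis using \<delta>(1) d nonneg by blast
qed

end

section \<open>From coordinates back to variations of the surface\<close>

context holomorphic_graph
begin

text \<open>By the area formula for the graph, \<open>varied_area\<close> equals
  \<open>K_area\<close> for small times, with \<open>F (t, u) = \<Phi> t (X u)\<close>; the
  derivatives carry over from there.\<close>

lemma varied_area_second_variation:
  assumes "variation (range X) K \<Phi>"
  shows "\<exists>A' d. (\<forall>\<^sub>F t in nhds 0. (varied_area (range X) K \<Phi> has_real_derivative A' t) (at t)) \<and>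
     (A' has_real_derivative d) (at 0) \<and> A' 0 = 0 \<and> 0 \<le> d"
proof -
  obtain \<epsilon> where K: "compact K" "K \<subseteq> range X" and \<Phi>0: "\<And>p. p \<in> range X \<Longrightarrow> \<Phi> 0 p = p"
    and eps: "\<epsilon> > 0" and out: "\<And>t p. t \<in> {-\<epsilon><..<\<epsilon>} \<Longrightarrow> p \<in> range X - K \<Longrightarrow> \<Phi> t p = p"
    and sm: "smooth_on ({-\<epsilon><..<\<epsilon>} \<times> UNIV) (\<lambda>(t, u). \<Phi> t (X u))"
    using assms local_parametrization_X unfolding variation_def by blast
  let ?K = "X -` K" and ?F = "\<lambda>(t, u). \<Phi> t (X u)"
  have K': "compact ?K" by (rule vimage_X_compact[OF K])
  obtain c where c: "?K \<subseteq> cbox (-c) c"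
    using bounded_subset_cbox_symmetric[OF compact_imp_bounded[OF K']] by blast
  interpret graph_variation f ?F \<epsilon> ?K "-c" c
  proof unfold_locales
    show "?F (0, u) = X u" for u using \<Phi>0[OF rangeI] by simp
    show "?F (t, u) = X u" if "\<bar>t\<bar> < \<epsilon>" "u \<notin> ?K" for t u
      using out[of t "X u"] that by (simp add: abs_less_iff)
  qed (use eps sm K' c in auto)
  have varied: "varied_area (range X) K \<Phi> t = K_area t" if t: "\<bar>t\<bar> < \<epsilon>" for t
  proof -
    have comp: "\<Phi> t \<circ> X = (\<lambda>u. ?F (t, u))" by (simp add: fun_eq_iff)
    have dens: "area_density (\<Phi> t \<circ> X) u = sqrt (gram (t, u))" for u
      unfolding comp by (rule area_density_slice[OF t])
    have cont: "continuous_on A (\<lambda>u. sqrt (gram (t, u)))" for A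
      by (intro continuous_intros continuous_on_slice[OF smooth_gram t])
    have nonneg: "sqrt (gram (t, u)) \<ge> 0" for u
      using area_density_nonneg[of "\<Phi> t \<circ> X" u] unfolding dens .
    have int: "((\<lambda>u. sqrt (gram (t, u))) has_integral K_area t) ?K"
    proof -
      have "(\<lambda>u. sqrt (gram (t, u))) absolutely_integrable_on cbox (-c) c"
        by (rule absolutely_integrable_continuous[OF cont])
      then have "(\<lambda>u. sqrt (gram (t, u))) absolutely_integrable_on ?K"
        by (rule set_integrable_subset[OF _ _ c]) (use K' in \<open>simp add: compact_imp_closed\<close>)
      then show ?thesis
        unfolding K_area_def using set_lebesgue_integral_eq_integral(1) integrable_integral by blast
    qed
    have "map_area (range X) (\<Phi> t) K = (\<integral>\<^sup>+u\<in>?K. ennreal (area_density (\<Phi> t \<circ> X) u) \<partial>lborel)"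
    proof (rule map_area_graph)
      show "(\<Phi> t \<circ> X) differentiable (at u)" for u
        unfolding comp using slice_derivative[OF t] differentiableI by blast
      show "continuous_on UNIV (area_density (\<Phi> t \<circ> X))"
        unfolding dens[abs_def] by (rule cont)
      show "?K \<in> sets borel" using K' by (simp add: compact_imp_closed)
    qed (rule K)
    \<comment> \<open>The area is finite, so \<open>enn2real\<close> returns it and not the default
      value that it assigns to infinity.\<close>
    also have "\<dots> = ennreal (K_area t)"
      using nn_integral_has_integral_lebesgue'[OF nonneg int]
      unfolding dens by (simp add: nn_integral_completion)
    finally show ?thesis
      unfolding varied_area_def using has_integral_nonneg[OF int nonneg] by (simp add: enn2real_ennreal)
  qed
  obtain \<delta> A' d where \<delta>: "\<delta> > 0" and A': "\<And>t. \<bar>t\<bar> < \<delta> \<Longrightarrow> (K_area has_real_derivative A' t) (at t)"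
    and d: "(A' has_real_derivative d) (at 0)" "A' 0 = 0" "0 \<le> d"
    using K_area_second_variation by blast
  have "(varied_area (range X) K \<Phi> has_real_derivative A' t) (at t)" if "\<bar>t\<bar> < min \<delta> \<epsilon>" for t
    by (rule has_field_derivative_transform_within_open[OF A', of _ "{-\<epsilon><..<\<epsilon>}"])
      (use that in \<open>auto simp: varied\<close>)
  then have "\<forall>\<^sub>F t in nhds 0. (varied_area (range X) K \<Phi> has_real_derivative A' t) (at t)"
    unfolding eventually_nhds_metric using \<delta> eps
    by (intro exI[of _ "min \<delta> \<epsilon>"]) (auto simp: dist_real_def)
  then show ?thesis using d by blast
qed

theorem stable_minimal_surface_graph: "stable_minimal_surface (range X)"
  unfolding stable_minimal_surface_def minimal_surface_def
proof (intro conjI allI impI smooth_surface_graph)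
  fix K \<Phi> assume *: "variation (range X) K \<Phi>"
  show "(varied_area (range X) K \<Phi> has_real_derivative 0) (at 0)"
    using varied_area_second_variation[OF *] eventually_nhds_x_imp_x by metis
  show "\<exists>A' d. (\<forall>\<^sub>F t in nhds 0. (varied_area (range X) K \<Phi> has_real_derivative A' t) (at t)) \<and>
     (A' has_real_derivative d) (at 0) \<and> 0 \<le> d"
    using varied_area_second_variation[OF *] by blast
qed

end

section \<open>Area growth\<close>

context holomorphic_graph
begin

lemma continuous_on_area_density_X: "continuous_on A (\<lambda>u. X\<^sub>1 u \<bullet> X\<^sub>1 u)"
proof -
  have "continuous_on UNIV X\<^sub>1"
    unfolding frechet_derivative_X(1)[symmetric, abs_def]
    by (intro smooth_on_imp_continuous_on smooth_on_frechet_derivative smooth_on_X)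
  then have "continuous_on A X\<^sub>1" by (rule continuous_on_subset) simp
  then show ?thesis by (intro continuous_on_inner)
qed

lemma area_graph:
  assumes "A \<subseteq> range X" "X -` A \<in> sets borel"
  shows "area (range X) A = (\<integral>\<^sup>+u\<in>X -` A. ennreal (X\<^sub>1 u \<bullet> X\<^sub>1 u) \<partial>lborel)"
proof -
  have comp: "(\<lambda>p. p) \<circ> X = X" by (simp add: comp_def)
  have "continuous_on UNIV (area_density X)"
    unfolding area_density_X[abs_def] by (rule continuous_on_area_density_X)
  moreover have "X differentiable (at u)" for u using has_derivative_X differentiableI by blast
  ultimately show ?thesis
    unfolding area_def using map_area_graph[of "\<lambda>p. p" A] assms
    by (simp only: comp area_density_X)
qed

end

text \<open>Of the two exponentials in \<open>2 * cos \<zeta>\<close>, one has modulus at least 3/2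
  and the other at most 1; the reverse triangle inequality leaves 1/2.\<close>

lemma norm_cos_ge:
  fixes \<zeta> :: complex
  assumes "1 / 2 \<le> Im \<zeta>"
  shows "1 / 4 \<le> norm (cos \<zeta>)"
proof -
  have "norm (exp (- (\<i> * \<zeta>))) - norm (exp (\<i> * \<zeta>)) \<le> norm (exp (- (\<i> * \<zeta>)) + exp (\<i> * \<zeta>))"
    using norm_diff_ineq by metis
  moreover have "norm (exp (- (\<i> * \<zeta>))) \<ge> 1 + 1/2"
  proof -
    have "1 + 1/2 \<le> exp (Im \<zeta>)" using exp_ge_add_one_self[of "Im \<zeta>"] assms by linarith
    then show ?thesis by simp
  qed
  moreover have "norm (exp (\<i> * \<zeta>)) \<le> 1" using assms by simp
  ultimately have "1/2 \<le> norm (exp (\<i> * \<zeta>) + exp (- (\<i> * \<zeta>)))" 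
    unfolding add.commute[of "exp (\<i> * \<zeta>)"] by linarith
  then show ?thesis unfolding cos_exp_eq by (simp add: norm_divide)
qed

text \<open>In this strip the two exponentials in \<open>sin \<zeta>\<close> have moduli at most 1
  and \<open>exp 1 \<le> 3\<close>, and they are divided by a number of modulus 2.\<close>

lemma norm_sin_le:
  fixes \<zeta> :: complex
  assumes "0 \<le> Im \<zeta>" "Im \<zeta> \<le> 1"
  shows "norm (sin \<zeta>) \<le> 2"
proof -
  have "norm (exp (\<i> * \<zeta>) - exp (- (\<i> * \<zeta>))) \<le> norm (exp (\<i> * \<zeta>)) + norm (exp (- (\<i> * \<zeta>)))"
    by (rule norm_triangle_ineq4)
  moreover have "norm (exp (\<i> * \<zeta>)) \<le> 1" using assms by simp
  moreover have "norm (exp (- (\<i> * \<zeta>))) \<le> 3"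
    using exp_le assms(2) order_trans[of "exp (Im \<zeta>)" "exp 1" 3] by simp
  ultimately have "norm (exp (\<i> * \<zeta>) - exp (- (\<i> * \<zeta>))) \<le> 4" by linarith
  then show ?thesis unfolding sin_exp_eq by (simp add: norm_divide norm_mult)
qed

text \<open>This is the Jacobian of a holomorphic map with derivative \<open>w\<close>: a rotation
  combined with a dilation.\<close>

lemma det_matrix_complex_mult:
  "det (matrix (\<lambda>v. vec_of_complex (w * complex_of_vec v))) = (norm w)\<^sup>2"
  by (simp add: det_2 matrix_def vec_of_complex_def cmod_power2 flip: power2_eq_square)

text \<open>Substituting a branch of the square root of \<open>Ln\<close> turns the area of a part
  of the graph into an integral over a rectangle, where the integrand has a uniform positive lower
  bound.\<close>

lemma area_sin_exp_square_growth:
  fixes f :: "complex \<Rightarrow> complex"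
  defines "f \<equiv> \<lambda>z. sin (exp (z\<^sup>2))"
  defines "S \<equiv> {(z, f z) | z. z \<in> UNIV}"
  assumes r: "r \<ge> 5"
  shows "area S (ball 0 r \<inter> S) \<ge> ennreal (exp (1/4 * r\<^sup>2))"
proof -
  interpret holomorphic_graph f
    by unfold_locales (auto simp: f_def intro!: holomorphic_intros)
  have S: "S = range X" unfolding S_def range_X ..
  define R where "R = exp (r\<^sup>2 / 2)"
  \<comment> \<open>Three estimates rest on this: \<open>R > 4\<close>, then
    \<open>r\<^sup>2 / 2 + 5 + 4 < r\<^sup>2\<close> for staying in the ball, and
    \<open>r\<^sup>2 / 4 \<ge> 6\<close> for the size of \<open>R\<close>.\<close>
  have r2: "r\<^sup>2 \<ge> 25" using power_mono[of 5 r 2] r by simp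
  have R: "R > 4" using exp_ge_add_one_self[of "r\<^sup>2/2"] r2 unfolding R_def by linarith
  define Q where "Q = cbox (vector [R/2, 1/2] :: real^2) (vector [R, 1])"
  have Q: "u \<in> Q \<longleftrightarrow> R/2 \<le> u $ 1 \<and> u $ 1 \<le> R \<and> 1/2 \<le> u $ 2 \<and> u $ 2 \<le> 1" for u
    unfolding Q_def by (auto simp: mem_box_cart forall_2)
  let ?\<zeta> = complex_of_vec
  have \<zeta>: "Re (?\<zeta> u) \<ge> R/2" "Re (?\<zeta> u) \<le> R" "1/2 \<le> Im (?\<zeta> u)" "Im (?\<zeta> u) \<le> 1" if "u \<in> Q" for u
    using that Q by (auto simp: complex_of_vec_def)
  have norm_\<zeta>: "norm (?\<zeta> u) > 1" "norm (?\<zeta> u) \<le> 2 * R" if "u \<in> Q" for u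
    using \<zeta>[OF that] R complex_Re_le_cmod[of "?\<zeta> u"] cmod_le[of "?\<zeta> u"] by auto
  \<comment> \<open>A logarithm with positive real part avoids the branch cut of
    \<open>csqrt\<close>, just as \<open>Re \<zeta> > 0\<close> avoids that of
    \<open>Ln\<close>.\<close>
  have Ln: "Re (Ln (?\<zeta> u)) > 0" if "u \<in> Q" for u
    using norm_\<zeta>[OF that] ln_gt_zero[of "norm (?\<zeta> u)"] by (subst Re_Ln) auto
  \<comment> \<open>A branch of the inverse of \<open>exp (z\<^sup>2)\<close> over the rectangle,
    followed by its derivative.\<close>
  define \<phi> where "\<phi> = (\<lambda>\<zeta>. csqrt (Ln \<zeta>))"
  define \<phi>' where "\<phi>' = (\<lambda>\<zeta>. 1 / (2 * \<zeta> * csqrt (Ln \<zeta>)))"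
  have nz: "?\<zeta> u \<noteq> 0" "csqrt (Ln (?\<zeta> u)) \<noteq> 0" "?\<zeta> u \<notin> \<real>\<^sub>\<le>\<^sub>0" "Ln (?\<zeta> u) \<notin> \<real>\<^sub>\<le>\<^sub>0" if "u \<in> Q" for u
    using norm_\<zeta>[OF that] Ln[OF that] \<zeta>[OF that] R
    by (auto simp: complex_nonpos_Reals_iff)
  have \<phi>: "(\<phi> has_field_derivative \<phi>' (?\<zeta> u)) (at (?\<zeta> u))" if "u \<in> Q" for u
    unfolding \<phi>_def \<phi>'_def using nz[OF that]
    by (auto intro!: derivative_eq_intros simp: field_simps)
  have f': "deriv f z = cos (exp (z\<^sup>2)) * exp (z\<^sup>2) * (2 * z)" for z
    unfolding f_def by (intro DERIV_imp_deriv) (auto intro!: derivative_eq_intros)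
  have exp_\<phi>: "exp ((\<phi> (?\<zeta> u))\<^sup>2) = ?\<zeta> u" if "u \<in> Q" for u
    using nz[OF that] by (simp add: \<phi>_def)
  \<comment> \<open>The derivative of the identity \<open>f (\<phi> \<zeta>) = sin \<zeta>\<close>,
    checked from the explicit formulas.\<close>
  have chain: "deriv f (\<phi> (?\<zeta> u)) * \<phi>' (?\<zeta> u) = cos (?\<zeta> u)" if "u \<in> Q" for u
    unfolding f' exp_\<phi>[OF that] using nz[OF that] by (simp add: \<phi>_def \<phi>'_def field_simps)
  define g where "g = (\<lambda>u. vec_of_complex (\<phi> (?\<zeta> u)))"
  define g' where "g' = (\<lambda>u v. vec_of_complex (\<phi>' (?\<zeta> u) * ?\<zeta> v))"
  have g: "(g has_derivative g' u) (at u)" if "u \<in> Q" for u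
  proof -
    have "((\<lambda>u. \<phi> (?\<zeta> u)) has_derivative (\<lambda>v. \<phi>' (?\<zeta> u) * ?\<zeta> v)) (at u)"
      using has_derivative_compose[OF bounded_linear_imp_has_derivative[OF bounded_linear_complex_of_vec]]
        \<phi>[OF that] unfolding has_field_derivative_def by blast
    from bounded_linear.has_derivative[OF bounded_linear_vec_of_complex this]
    show ?thesis unfolding g_def g'_def .
  qed
  have cont_g: "continuous_on Q g"
    using g has_derivative_continuous continuous_at_imp_continuous_on by blast
  have inj_g: "inj_on g Q"
  proof (rule inj_onI)
    fix u v assume "u \<in> Q" "v \<in> Q" "g u = g v"
    then have "\<phi> (?\<zeta> u) = \<phi> (?\<zeta> v)" unfolding g_def by (metis complex_of_vec_of_complex)
    then have "?\<zeta> u = ?\<zeta> v" using exp_\<phi> \<open>u \<in> Q\<close> \<open>v \<in> Q\<close> by metis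
    then show "u = v" by (metis vec_of_complex_of_vec)
  qed
  \<comment> \<open>To the squared norm the first coordinate contributes |Ln \<zeta>|, at most
    \<open>r\<^sup>2 / 2 + 1\<close> from the modulus of \<zeta> and 4 from its argument; the second
    coordinate contributes at most 4.\<close>
  have gQ: "g ` Q \<subseteq> X -` (ball 0 r \<inter> S)"
  proof (intro image_subsetI vimageI2 IntI)
    fix u assume u: "u \<in> Q"
    show "X (g u) \<in> S" unfolding S by simp
    have X: "X (g u) = (\<phi> (?\<zeta> u), sin (?\<zeta> u))"
      unfolding X_def g_def using exp_\<phi>[OF u] by (simp add: f_def)
    have "(norm (\<phi> (?\<zeta> u)))\<^sup>2 = norm (Ln (?\<zeta> u))"
      unfolding \<phi>_def norm_power[symmetric] by simp
    also have "\<dots> \<le> \<bar>ln (norm (?\<zeta> u))\<bar> + \<bar>Im (Ln (?\<zeta> u))\<bar>"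
      using cmod_le[of "Ln (?\<zeta> u)"] nz[OF u] by simp
    also have "\<dots> \<le> (r\<^sup>2 / 2 + 1) + 4"
    proof (rule add_mono)
      have "ln (norm (?\<zeta> u)) \<le> ln (2 * R)"
        using norm_\<zeta>[OF u] R by (subst ln_le_cancel_iff) linarith+
      also have "\<dots> = ln 2 + r\<^sup>2 / 2" by (simp add: R_def ln_mult)
      also have "\<dots> \<le> r\<^sup>2 / 2 + 1" using ln_2_less_1 by simp
      finally show "\<bar>ln (norm (?\<zeta> u))\<bar> \<le> r\<^sup>2 / 2 + 1" using norm_\<zeta>[OF u] by simp
      show "\<bar>Im (Ln (?\<zeta> u))\<bar> \<le> 4"
        using mpi_less_Im_Ln[OF nz(1)[OF u]] Im_Ln_le_pi[OF nz(1)[OF u]] pi_less_4 by linarith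
    qed
    finally have 1: "(norm (\<phi> (?\<zeta> u)))\<^sup>2 \<le> r\<^sup>2 / 2 + 5" by simp
    have "norm (sin (?\<zeta> u)) \<le> 2" using \<zeta>[OF u] by (intro norm_sin_le) auto
    then have 2: "(norm (sin (?\<zeta> u)))\<^sup>2 \<le> 2\<^sup>2" by (intro power_mono) auto
    have "(norm (X (g u)))\<^sup>2 < r\<^sup>2" unfolding X norm_Pair using 1 2 r2 by simp
    then show "X (g u) \<in> ball 0 r" using r by (simp add: power2_less_imp_less)
  qed
  have det: "det (matrix (g' u)) = (norm (\<phi>' (?\<zeta> u)))\<^sup>2" for u
    unfolding g'_def by (rule det_matrix_complex_mult)
  \<comment> \<open>The area density is 1 + |f'|^2; dropping the 1, its product with the Jacobian is
    |cos \<zeta>|^2 by \<open>chain\<close>.\<close>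
  have lower: "1 / 16 \<le> \<bar>det (matrix (g' u))\<bar> * (X\<^sub>1 (g u) \<bullet> X\<^sub>1 (g u))" if u: "u \<in> Q" for u
  proof -
    have "(1/4)\<^sup>2 \<le> (norm (cos (?\<zeta> u)))\<^sup>2" using norm_cos_ge \<zeta>(3)[OF u] by (intro power_mono) auto
    also have "\<dots> = (norm (\<phi>' (?\<zeta> u)))\<^sup>2 * (norm (deriv f (\<phi> (?\<zeta> u))))\<^sup>2"
      unfolding chain[OF u, symmetric] by (simp add: norm_mult power_mult_distrib)
    also have "\<dots> \<le> \<bar>det (matrix (g' u))\<bar> * (X\<^sub>1 (g u) \<bullet> X\<^sub>1 (g u))"
      unfolding det by (intro mult_mono) (simp_all add: X\<^sub>1_def g_def inner_prod_def power2_norm_eq_inner)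
    finally show ?thesis by (simp add: power2_eq_square)
  qed
  \<comment> \<open>\<open>R\<close> is the square of \<open>exp (r\<^sup>2 / 4)\<close>, so one
    factor can absorb 64: it is at least \<open>exp 6\<close>, hence at least
    \<open>2 ^ 6\<close>.\<close>
  have "exp (1/4 * r\<^sup>2) \<le> R / 64"
  proof -
    have "(2::real) ^ 6 \<le> exp 1 ^ 6" using exp_ge_add_one_self[of 1] by (intro power_mono) auto
    also have "\<dots> = exp 6" by (simp add: exp_of_nat_mult[symmetric])
    also have "\<dots> \<le> exp (1/4 * r\<^sup>2)" using r2 by simp
    finally have "64 * exp (1/4 * r\<^sup>2) \<le> exp (1/4 * r\<^sup>2) * exp (1/4 * r\<^sup>2)" by simp
    also have "\<dots> = R" by (simp add: R_def exp_add[symmetric])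
    finally show ?thesis by simp
  qed
  \<comment> \<open>\<open>R / 64\<close> splits into the pointwise bound 1/16 and the area
    \<open>R / 4\<close> of \<open>Q\<close>, whose sides are \<open>R / 2\<close> and
    \<open>1 / 2\<close>.\<close>
  then have "ennreal (exp (1/4 * r\<^sup>2)) \<le> ennreal (1/16) * ennreal (R/4)"
    using R by (subst ennreal_mult[symmetric]) (auto intro: ennreal_leI)
  also have "ennreal (R/4) = emeasure lborel Q"
  proof -
    have "cbox (vector [R/2, 1/2] :: real^2) (vector [R, 1]) \<noteq> {}"
      using R by (simp add: interval_ne_empty_cart forall_2)
    then have "measure lborel Q = R / 4" unfolding Q_def by (simp add: content_cbox_cart UNIV_2)
    moreover have "emeasure lborel Q = ennreal (measure lborel Q)" unfolding Q_def
      by (intro emeasure_eq_ennreal_measure)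
        (metis emeasure_lborel_cbox_finite infinity_ennreal_def order_less_irrefl)
    ultimately show ?thesis by metis
  qed
  also have "ennreal (1/16) * emeasure lborel Q = (\<integral>\<^sup>+u\<in>Q. ennreal (1/16) \<partial>lborel)"
    by (simp add: Q_def nn_integral_cmult_indicator)
  also have "\<dots> \<le> (\<integral>\<^sup>+u\<in>Q. ennreal (\<bar>det (matrix (g' u))\<bar> * (X\<^sub>1 (g u) \<bullet> X\<^sub>1 (g u))) \<partial>lborel)"
    using lower by (intro nn_integral_mono) (auto split: split_indicator intro: ennreal_leI)
  also have "\<dots> = (\<integral>\<^sup>+u\<in>g ` Q. ennreal (X\<^sub>1 u \<bullet> X\<^sub>1 u) \<partial>lborel)"
  proof (rule nn_integral_change_of_variables)
    show "(g has_derivative g' u) (at u within Q)" if "u \<in> Q" for u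
      by (rule has_derivative_at_withinI[OF g[OF that]])
    have c: "continuous_on Q (\<lambda>u. \<phi>' (?\<zeta> u))"
    proof -
      have \<zeta>c: "continuous_on Q ?\<zeta>" by (rule linear_continuous_on[OF bounded_linear_complex_of_vec])
      have "continuous_on Q (\<lambda>u. complex_of_vec (g u))"
        by (rule bounded_linear.continuous_on[OF bounded_linear_complex_of_vec cont_g])
      then have "continuous_on Q (\<lambda>u. csqrt (Ln (?\<zeta> u)))" by (simp add: g_def \<phi>_def)
      then show ?thesis unfolding \<phi>'_def
        by (intro continuous_on_divide continuous_on_mult continuous_on_const \<zeta>c) (use nz in auto)
    qed
    have "continuous_on Q (\<lambda>u. \<bar>det (matrix (g' u))\<bar> * (X\<^sub>1 (g u) \<bullet> X\<^sub>1 (g u)))"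
      unfolding det
      by (intro continuous_on_mult continuous_on_rabs continuous_on_power continuous_on_norm c
          continuous_on_compose2[OF continuous_on_area_density_X cont_g subset_UNIV])
    from borel_measurable_continuous_on_indicator[OF _ this]
    show "(\<lambda>u. indicator Q u * (\<bar>det (matrix (g' u))\<bar> * (X\<^sub>1 (g u) \<bullet> X\<^sub>1 (g u)))) \<in> borel_measurable lebesgue"
      by (auto simp: Q_def intro: measurable_completion)
    have "compact (g ` Q)" by (rule compact_continuous_image[OF cont_g]) (simp add: Q_def)
    from borel_measurable_continuous_on_indicator[OF _ continuous_on_area_density_X, of "g ` Q"]
    show "(\<lambda>u. indicator (g ` Q) u * (X\<^sub>1 u \<bullet> X\<^sub>1 u)) \<in> borel_measurable lebesgue"
      using \<open>compact (g ` Q)\<close> by (auto simp: compact_imp_closed intro: measurable_completion)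
  qed (auto simp: Q_def inj_g[unfolded Q_def])
  also have "\<dots> \<le> (\<integral>\<^sup>+u\<in>X -` (ball 0 r \<inter> S). ennreal (X\<^sub>1 u \<bullet> X\<^sub>1 u) \<partial>lborel)"
    using gQ by (intro nn_integral_mono) (auto split: split_indicator)
  also have "\<dots> = area S (ball 0 r \<inter> S)"
  proof -
    have "X -` (ball 0 r \<inter> S) = X -` ball 0 r" unfolding S by auto
    then have "open (X -` (ball 0 r \<inter> S))" by (simp only: open_vimage[OF open_ball continuous_on_X])
    then show ?thesis unfolding S by (intro area_graph[symmetric]) auto
  qed
  finally show ?thesis .
qed

theorem theorem2p12:
  fixes f :: "complex \<Rightarrow> complex" and S :: "(complex \<times> complex) set"
  assumes f: "f = (\<lambda>z. sin (exp (z\<^sup>2)))"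
    and S: "S = {(z, f z) | z. z \<in> UNIV}"
  shows "smooth_surface S \<and> stable_minimal_surface S \<and>
    (\<exists>c>0. \<exists>r0>0. \<forall>r\<ge>r0. area S (ball 0 r \<inter> S) \<ge> ennreal (exp (c * r\<^sup>2)))"
proof -
  interpret holomorphic_graph f
    by unfold_locales (auto simp: f intro!: holomorphic_intros)
  have range: "S = range X" unfolding S range_X ..
  have "area S (ball 0 r \<inter> S) \<ge> ennreal (exp (1/4 * r\<^sup>2))" if "r \<ge> 5" for r
    using area_sin_exp_square_growth[OF that] unfolding S f .
  then show ?thesis
    using smooth_surface_graph stable_minimal_surface_graph unfolding range
    by (intro conjI exI[of _ "1/4"] exI[of _ 5]) auto
qed

end
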